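(* Suppose that $e_1^{\max}|_{e_0^{\max}}\neq a_{0n}-a_{00}$ and let $$\delta=(a_{0n}-a_{0R}^+)(a_{1L}^+-a_{10})-(a_{0L}^+-a_{00})(a_{1m}-a_{1R}^+).$$ Then, under Selection1: (1) none of $a_{00},a_{10}$ is selected or none of $a_{0n},a_{1m}$ is selected, which also implies that $e_0^{\max}|_{e_1^{\max}}\neq a_{1m}-a_{10}$; (2) the upper right corner of $N(\phi)$ consists of a single edge connecting $(a_{1m}-a_{10},e_1^{\max}|_{e_0^{\max}})$ and $(e_0^{\max}|_{e_1^{\max}},a_{0n}-a_{00})$, unless none of $a_{00},a_{10},a_{0n},a_{1m}$ is selected and $\delta\neq0$, in which case the corner consists of two edges connecting $(a_{1m}-a_{10},e_1^{\max}|_{e_0^{\max}})$ to a point $p$, and $p$ to $(e_0^{\max}|_{e_1^{\max}},a_{0n}-a_{00})$, where $$p=(a_{1m}-a_{1L}^+,\,a_{0R}^+-a_{00})\ \text{ if }\delta<0,\qquad p=(a_{1R}^+-a_{10},\,a_{0n}-a_{0L}^+)\ \text{ if }\delta>0.$$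
   Context: Consider $x=P_0(t)/Q_0(t)$, $y=P_1(t)/Q_1(t)$ with $P_i,Q_i\in\mathbb{C}[t]$, $\gcd(P_i,Q_i)=1$, where all polynomials have fixed supports and (independent) generic coefficients (the result holds for all coefficient vectors in some open dense subset), and the parameterization has degree $1$. Let $\phi\in\mathbb{C}[x,y]$ be the implicit equation (generator of the ideal of polynomials vanishing on the parameterization) and $N(\phi)$ its Newton polygon (convex hull of the exponent vectors occurring in $\phi$). Let $f_0=xQ_0(t)-P_0(t)$, $f_1=yQ_1(t)-P_1(t)$, with supports in $t$: $A_0=\{a_{00}<a_{01}<\dots<a_{0n}\}$, $A_1=\{a_{10}<a_{11}<\dots<a_{1m}\}$, $A_i=\mathrm{supp}(P_i)\cup\mathrm{supp}(Q_i)$; by coprimality $a_{00}=a_{10}=0$. Selection1: a point of $A_i$ is selected iff it belongs to $\mathrm{supp}(Q_i)$ (i.e. its coefficient in $f_i$ is a non-constant polynomial in $x$, resp. $y$); at least one point of each $A_i$ is selected. Let $a_{iL}^+,a_{iR}^+$ denote the leftmost and rightmost selected points of $A_i$ (not necessarily distinct), under Selection1. Let $C=\{(a,0):a\in A_0\}\cup\{(a,1):a\in A_1\}\subset\mathbb{R}^2$. A triangulation of $C$ is a subdivision of its convex hull into triangles with vertices in $C$; each triangle has two vertices on one of the two rows (its base) and one on the other row (its apex), and its normalized volume is the length of its base. For a triangulation, let $e_0$ be the sum of the normalized volumes of the triangles whose apex is a selected point of $A_0$ (base in $A_1$), and $e_1$ the sum of the normalized volumes of the triangles whose apex is a selected point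 of $A_1$ (base in $A_0$). Write $e_i^{\max}$ for the maximum of $e_i$ over all triangulations, $e_1^{\max}|_{e_0^{\max}}$ for the maximum of $e_1$ among the triangulations with $e_0=e_0^{\max}$, and $e_0^{\max}|_{e_1^{\max}}$ for the maximum of $e_0$ among the triangulations with $e_1=e_1^{\max}$, all under Selection1. The upper right corner of $N(\phi)$ is the part of its boundary between the points $(a_{1m}-a_{10},e_1^{\max}|_{e_0^{\max}})$ and $(e_0^{\max}|_{e_1^{\max}},a_{0n}-a_{00})$. *)

theory Defs
  imports "HOL-Analysis.Analysis" "HOL-Computational_Algebra.Polynomial"
begin

subsection \<open>Families of rational parameterizations with fixed supports\<close>

datatype part = P0 | Q0 | P1 | Q1

text \<open>
  A map \<open>S\<close> from \<^typ>\<open>part\<close> to finite sets of exponents prescribes the supports of the four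
  polynomials; a coefficient vector is a point of the finite-dimensional complex space with one
  independent coordinate \<open>c (p, k)\<close> for each \<open>p\<close> and each \<open>k \<in> S p\<close>.
\<close>

definition coeff_space :: "(part \<Rightarrow> nat set) \<Rightarrow> (part \<times> nat \<Rightarrow> complex) topology" where
  "coeff_space S = product_topology (\<lambda>_. euclidean) (SIGMA p:UNIV. S p)"

definition part_poly :: "(part \<Rightarrow> nat set) \<Rightarrow> (part \<times> nat \<Rightarrow> complex) \<Rightarrow> part \<Rightarrow> complex poly" where
  "part_poly S c p = (\<Sum>k\<in>S p. monom (c (p, k)) k)"

definition generically ::
  "(part \<Rightarrow> nat set) \<Rightarrow> ((part \<times> nat \<Rightarrow> complex) \<Rightarrow> bool) \<Rightarrow> bool" where
  "generically S R \<longleftrightarrow>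
     (\<exists>U. openin (coeff_space S) U \<and> coeff_space S closure_of U = topspace (coeff_space S) \<and>
          (\<forall>c\<in>U. R c))"

text \<open>
  In the following, \<open>F\<close> gives the polynomials of the parameterization
  \<open>x = F P0 / F Q0\<close>, \<open>y = F P1 / F Q1\<close>.
\<close>

definition param_dom :: "(part \<Rightarrow> complex poly) \<Rightarrow> complex set" where
  "param_dom F = {t. poly (F Q0) t \<noteq> 0 \<and> poly (F Q1) t \<noteq> 0}"

definition param :: "(part \<Rightarrow> complex poly) \<Rightarrow> complex \<Rightarrow> complex \<times> complex" where
  "param F t = (poly (F P0) t / poly (F Q0) t, poly (F P1) t / poly (F Q1) t)"

text \<open>
  The degree of a parameterization is the number of parameter values over a general point of
  the curve; an infinite fibre has \<^const>\<open>card\<close> equal to 0, so a constant map does not have degree 1.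
\<close>

definition has_param_degree :: "(part \<Rightarrow> complex poly) \<Rightarrow> nat \<Rightarrow> bool" where
  "has_param_degree F d \<longleftrightarrow>
     finite {t \<in> param_dom F. card {s \<in> param_dom F. param F s = param F t} \<noteq> d}"

subsection \<open>Implicit equation and Newton polygon\<close>

text \<open>
  An element \<open>\<phi>\<close> of \<^typ>\<open>complex poly poly\<close> is read as a polynomial in \<open>y\<close> over the polynomials
  in \<open>x\<close>: the coefficient of \<open>x^i y^j\<close> is \<open>coeff (coeff \<phi> j) i\<close>.
\<close>

definition eval2 :: "complex poly poly \<Rightarrow> complex \<times> complex \<Rightarrow> complex" where
  "eval2 \<phi> = (\<lambda>(x, y). poly (poly \<phi> [:y:]) x)"

definition vanishing_ideal :: "(part \<Rightarrow> complex poly) \<Rightarrow> complex poly poly set" where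
  "vanishing_ideal F = {\<psi>. \<forall>t\<in>param_dom F. eval2 \<psi> (param F t) = 0}"

definition implicit_equation :: "(part \<Rightarrow> complex poly) \<Rightarrow> complex poly poly \<Rightarrow> bool" where
  "implicit_equation F \<phi> \<longleftrightarrow> vanishing_ideal F = {\<phi> * \<psi> |\<psi>. True}"

definition lattice_pt :: "nat \<times> nat \<Rightarrow> real \<times> real" where
  "lattice_pt = (\<lambda>(i, j). (real i, real j))"

definition newton_polygon :: "complex poly poly \<Rightarrow> (real \<times> real) set" where
  "newton_polygon \<phi> = convex hull (lattice_pt ` {(i, j). coeff (coeff \<phi> j) i \<noteq> 0})"

text \<open>
  The part, from \<open>a\<close> (lower right) to \<open>b\<close> (upper left), of the upper right boundary of \<open>N\<close>. The
  second condition says that \<open>N\<close> contains no point strictly above and to the right of \<open>z\<close>; it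
  excludes the other boundary arc joining \<open>a\<close> and \<open>b\<close>, even when that arc is the chord from
  \<open>a\<close> to \<open>b\<close>.
\<close>

definition upper_right_corner ::
  "(real \<times> real) set \<Rightarrow> real \<times> real \<Rightarrow> real \<times> real \<Rightarrow> (real \<times> real) set" where
  "upper_right_corner N a b =
     {z \<in> frontier N. (\<forall>w\<in>N. \<not> (fst z < fst w \<and> snd z < snd w)) \<and>
        fst b \<le> fst z \<and> fst z \<le> fst a \<and> snd a \<le> snd z \<and> snd z \<le> snd b}"

subsection \<open>Triangulations of two-row point configurations\<close>

definition config :: "nat set \<Rightarrow> nat set \<Rightarrow> (real \<times> real) set" where
  "config A B = lattice_pt ` (A \<times> {0} \<union> B \<times> {1})"

definition triangulations_of :: "(real \<times> real) set \<Rightarrow> (real \<times> real) set set set" where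
  "triangulations_of C =
     {\<T>. triangulation \<T> \<and> (\<forall>T\<in>\<T>. 2 simplex T \<and> {v. v extreme_point_of T} \<subseteq> C) \<and>
         \<Union>\<T> = convex hull C}"

text \<open>
  Sum of the base lengths \<open>b' - b\<close> of the triangles of \<open>\<T>\<close> with apex \<open>a \<in> Sel\<close> on row \<open>r\<close> and base
  vertices \<open>b < b'\<close> in \<open>B\<close> on row \<open>s\<close>. A triangle determines its vertices, so each triangle is
  counted once.
\<close>

definition apex_sum ::
  "nat set \<Rightarrow> nat \<Rightarrow> nat set \<Rightarrow> nat \<Rightarrow> (real \<times> real) set set \<Rightarrow> nat" where
  "apex_sum Sel r B s \<T> =
     (\<Sum>(a, b, b') \<in> {(a, b, b') \<in> Sel \<times> B \<times> B. b < b' \<and>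
          convex hull {lattice_pt (a, r), lattice_pt (b, s), lattice_pt (b', s)} \<in> \<T>}. b' - b)"

text \<open>The maximum of \<open>f\<close> over those elements of \<open>D\<close> at which \<open>g\<close> attains its maximum over \<open>D\<close>.\<close>

definition cond_max :: "('a \<Rightarrow> nat) \<Rightarrow> ('a \<Rightarrow> nat) \<Rightarrow> 'a set \<Rightarrow> nat" where
  "cond_max f g D = Max (f ` {T \<in> D. g T = Max (g ` D)})"

subsection \<open>The data attached to the supports\<close>

definition A0 :: "(part \<Rightarrow> nat set) \<Rightarrow> nat set" where "A0 S = S P0 \<union> S Q0"
definition A1 :: "(part \<Rightarrow> nat set) \<Rightarrow> nat set" where "A1 S = S P1 \<union> S Q1"

text \<open>
  The selected points of \<open>A0 S\<close> and \<open>A1 S\<close> are those of \<open>S Q0\<close> and \<open>S Q1\<close>: the coefficients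
  of \<open>t^k\<close> in \<open>x * Q0(t) - P0(t)\<close> and \<open>y * Q1(t) - P1(t)\<close> involve \<open>x\<close>, \<open>y\<close> exactly for these \<open>k\<close>.
\<close>

definition e0 :: "(part \<Rightarrow> nat set) \<Rightarrow> (real \<times> real) set set \<Rightarrow> nat" where
  "e0 S = apex_sum (S Q0) 0 (A1 S) 1"

definition e1 :: "(part \<Rightarrow> nat set) \<Rightarrow> (real \<times> real) set set \<Rightarrow> nat" where
  "e1 S = apex_sum (S Q1) 1 (A0 S) 0"

definition e1_max_e0_max :: "(part \<Rightarrow> nat set) \<Rightarrow> nat" where
  "e1_max_e0_max S = cond_max (e1 S) (e0 S) (triangulations_of (config (A0 S) (A1 S)))"

definition e0_max_e1_max :: "(part \<Rightarrow> nat set) \<Rightarrow> nat" where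
  "e0_max_e1_max S = cond_max (e0 S) (e1 S) (triangulations_of (config (A0 S) (A1 S)))"

definition delta :: "(part \<Rightarrow> nat set) \<Rightarrow> int" where
  "delta S =
     (int (Max (A0 S)) - int (Max (S Q0))) * (int (Min (S Q1)) - int (Min (A1 S)))
     - (int (Min (S Q0)) - int (Min (A0 S))) * (int (Max (A1 S)) - int (Max (S Q1)))"

definition no_min_selected :: "(part \<Rightarrow> nat set) \<Rightarrow> bool" where
  "no_min_selected S \<longleftrightarrow> Min (A0 S) \<notin> S Q0 \<and> Min (A1 S) \<notin> S Q1"

definition no_max_selected :: "(part \<Rightarrow> nat set) \<Rightarrow> bool" where
  "no_max_selected S \<longleftrightarrow> Max (A0 S) \<notin> S Q0 \<and> Max (A1 S) \<notin> S Q1"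

definition right_pt :: "(part \<Rightarrow> nat set) \<Rightarrow> real \<times> real" where
  "right_pt S = lattice_pt (Max (A1 S) - Min (A1 S), e1_max_e0_max S)"

definition top_pt :: "(part \<Rightarrow> nat set) \<Rightarrow> real \<times> real" where
  "top_pt S = lattice_pt (e0_max_e1_max S, Max (A0 S) - Min (A0 S))"

definition middle_pt :: "(part \<Rightarrow> nat set) \<Rightarrow> real \<times> real" where
  "middle_pt S =
     (if delta S < 0 then lattice_pt (Max (A1 S) - Min (S Q1), Max (S Q0) - Min (A0 S))
      else lattice_pt (Max (S Q1) - Min (A1 S), Max (A0 S) - Min (S Q0)))"

end

theory Submission
  imports Defs "HOL-Computational_Algebra.Fundamental_Theorem_Algebra"
begin

text \<open>
  An edge of the Newton polygon of a plane curve whose outer normal has two positive coordinates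
  records a point of the parameter line at which both coordinate functions have a pole, and the
  two pole orders form that normal. For generic coefficients \<open>Q0\<close> and \<open>Q1\<close> have no common
  root apart from \<open>0\<close>, so only \<open>t = 0\<close> and \<open>t = \<infinity>\<close> can contribute. The normals are
  \<open>(a0, b0) = (Min (S Q0), Min (S Q1))\<close> and
  \<open>(a1, b1) = (Max (A0 S) - Max (S Q0), Max (A1 S) - Max (S Q1))\<close>, where a pair counts only
  if both of its entries are positive, which is what \<open>no_min_selected\<close> and
  \<open>no_max_selected\<close> say. The upper right corner therefore has at most two edges, and
  \<open>delta\<close> is the determinant of the two normals: it tells which edge comes first,
  and the two edges merge if it vanishes.

  The quantitative statement behind this picture is a formula for the support function of the
  Newton polygon. Let \<open>m\<close> and \<open>n\<close> be the degrees of the coordinate functions \<open>y(t)\<close> and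
  \<open>x(t)\<close>. For coprime \<open>u, v > 0\<close> the maximum of \<open>u i + v j\<close> over the monomials
  \<open>x\<^sup>i y\<^sup>j\<close> of the implicit equation equals the degree of the rational function
  \<open>z(t) = (x(t) - \<xi>)\<^sup>v / (y(t) - \<eta>)\<^sup>u\<close> for general \<open>\<xi>, \<eta>\<close>, that is,
  \<open>u m + v n - min (u b0) (v a0) - min (u b1) (v a1)\<close>
  (\<open>weighted_degree_implicit_equation\<close>). To see this, substitute the arc
  \<open>s \<mapsto> (\<xi> + \<kappa> s\<^sup>u, \<eta> + s\<^sup>v)\<close> into \<open>\<phi>\<close>; for general \<open>\<kappa>\<close> the result is a polynomial in
  \<open>s\<close> whose degree is the maximum in question. Because the parameterization has degree 1, each
  of the \<open>deg z\<close> parameters with \<open>z(t) = \<kappa>\<^sup>v\<close> yields its own root \<open>s\<close>, which bounds the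
  degree from below (\<open>height_le_weighted_degree\<close>). Conversely, a dimension count produces a
  multiple of \<open>\<phi>\<close> which after the same substitution has, apart from a power of \<open>s\<close>, degree
  at most \<open>deg z\<close> (\<open>exists_vanishing_of_bounded_width\<close>). The support function in the
  directions of the two normals gives the supporting lines of the edges. In a direction between
  the two normals, or between a normal and a coordinate direction, its maximum can only be attained
  at the vertex where the corresponding lines meet, so the expected vertices do occur
  (\<open>single_edge\<close>, \<open>two_edges\<close>).

  It remains to match the end points of the corner with triangulations. If \<open>e0\<close> is maximal, the
  whole second row is covered by bases of triangles with a selected apex. If in addition neither
  leftmost point is selected, the edges of a triangle with selected apex on the second row and base
  to the left of \<open>Min (S Q0)\<close> would cross the leftmost triangle of that cover. So \<open>e1\<close> loses
  \<open>Min (S Q0)\<close>, and by symmetry a similar amount on the right (\<open>apex_sum_le_of_full\<close>);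
  a strip of at most five triangles loses nothing else (\<open>exists_optimal_triangulation\<close>).
\<close>

section \<open>Polynomials in one variable\<close>

text \<open>
  Gaussian elimination on coefficients: the leading coefficient of one polynomial is used to lower
  the degree bound of the others.
\<close>

lemma linear_relation:
  fixes g :: "'i \<Rightarrow> complex poly"
  assumes "finite I" "card I > N" "\<And>i k. i \<in> I \<Longrightarrow> k \<ge> N \<Longrightarrow> coeff (g i) k = 0"
  shows "\<exists>a. (\<exists>i\<in>I. a i \<noteq> 0) \<and> (\<Sum>i\<in>I. smult (a i) (g i)) = 0"
  using assms
proof (induction N arbitrary: I g)
  case 0
  then have "g i = 0" if "i \<in> I" for i
    using that by (intro poly_eqI) auto
  moreover obtain i where "i \<in> I" using 0 by fastforce
  ultimately show ?case by (intro exI[of _ "\<lambda>_. 1"]) auto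
next
  case (Suc N)
  show ?case
  proof (cases "\<forall>i\<in>I. coeff (g i) N = 0")
    case True
    then have "coeff (g i) k = 0" if "i \<in> I" "k \<ge> N" for i k
      using that Suc.prems(3) by (cases "k = N") auto
    then show ?thesis using Suc.IH[of I g] Suc.prems by auto
  next
    case False
    then obtain i0 where i0: "i0 \<in> I" "coeff (g i0) N \<noteq> 0" by auto
    define d where "d i = coeff (g i) N / coeff (g i0) N" for i
    define g' where "g' i = g i - smult (d i) (g i0)" for i
    have "coeff (g' i) k = 0" if "i \<in> I - {i0}" "k \<ge> N" for i k
      using that Suc.prems(3)[of i k] Suc.prems(3)[of i0 k] i0
      by (cases "k = N") (auto simp: g'_def d_def)
    moreover have "card (I - {i0}) > N" using Suc.prems i0 by simp
    ultimately obtain a where a: "\<exists>i\<in>I - {i0}. a i \<noteq> 0" "(\<Sum>i\<in>I - {i0}. smult (a i) (g' i)) = 0"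
      using Suc.IH[of "I - {i0}" g'] Suc.prems by auto
    define b where "b = a(i0 := - (\<Sum>i\<in>I - {i0}. a i * d i))"
    have "(\<Sum>i\<in>I. smult (b i) (g i)) = smult (b i0) (g i0) + (\<Sum>i\<in>I - {i0}. smult (b i) (g i))"
      using i0 Suc.prems by (simp add: sum.remove)
    also have "(\<Sum>i\<in>I - {i0}. smult (b i) (g i)) = (\<Sum>i\<in>I - {i0}. smult (a i) (g' i) + smult (a i * d i) (g i0))"
      by (rule sum.cong) (auto simp: b_def g'_def algebra_simps smult_diff_right)
    also have "\<dots> = smult (\<Sum>i\<in>I - {i0}. a i * d i) (g i0)"
      by (simp add: sum.distrib a(2) smult_sum)
    finally have "(\<Sum>i\<in>I. smult (b i) (g i)) = 0"
      by (simp add: b_def)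
    moreover have "\<exists>i\<in>I. b i \<noteq> 0" using a(1) by (auto simp: b_def)
    ultimately show ?thesis by blast
  qed
qed

text \<open>
  The leading terms of \<open>A\<close> and \<open>\<kappa> B\<close> cancel for at most one value
  of \<open>\<kappa>\<close>.
\<close>

lemma cofinite_degree_pencil:
  fixes A B :: "complex poly"
  shows "finite {\<kappa>. degree (A - smult \<kappa> B) \<noteq> max (degree A) (degree B)}" (is "finite ?S")
proof -
  define H where "H = max (degree A) (degree B)"
  have le: "degree (A - smult \<kappa> B) \<le> H" for \<kappa>
    unfolding H_def by (meson degree_diff_le_max degree_smult_le le_max_iff_disj max.mono order_trans order_refl)
  have "?S \<subseteq> {coeff A H / coeff B H}"
  proof
    fix \<kappa> assume "\<kappa> \<in> ?S"
    then have lt: "degree (A - smult \<kappa> B) < H" using le[of \<kappa>] by (simp add: H_def)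
    then have "coeff A H = \<kappa> * coeff B H" by (metis coeff_diff coeff_eq_0 coeff_smult eq_iff_diff_eq_0)
    moreover have "coeff A H \<noteq> 0 \<or> coeff B H \<noteq> 0"
      using lt unfolding H_def max_def
      by (metis degree_0 leading_coeff_0_iff not_less_zero)
    ultimately show "\<kappa> \<in> {coeff A H / coeff B H}" by auto
  qed
  then show ?thesis by (rule finite_subset) simp
qed

text \<open>
  Compare orders at a root of \<open>A\<close>: differentiation lowers the order of
  \<open>A\<close> by one, whereas \<open>B\<close> does not vanish there.
\<close>

lemma wronskian_nonzero:
  fixes A B :: "complex poly"
  assumes nc: "\<And>t. poly A t = 0 \<Longrightarrow> poly B t \<noteq> 0" and "degree A > 0"
  shows "pderiv A * B \<noteq> A * pderiv B"
proof
  assume eq: "pderiv A * B = A * pderiv B"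
  obtain r where r: "poly A r = 0"
    using fundamental_theorem_of_algebra[of A] \<open>degree A > 0\<close> by (auto simp: constant_degree)
  have A0: "A \<noteq> 0" "pderiv A \<noteq> 0" using \<open>degree A > 0\<close> by (auto simp: pderiv_eq_0_iff)
  have B0: "poly B r \<noteq> 0" using nc r by auto
  then have B1: "B \<noteq> 0" by auto
  then have ne: "pderiv A * B \<noteq> 0" using A0 by simp
  then have ne': "A * pderiv B \<noteq> 0" using eq by simp
  have "order r A \<noteq> 0" using r A0 by (simp add: order_root)
  then have "order r A = Suc (order r (pderiv A))" using A0 r by (intro order_pderiv)
  moreover have "order r (pderiv A * B) = order r (pderiv A)"
    using order_mult[OF ne] B0 by (simp add: order_0I)
  moreover have "order r (A * pderiv B) \<ge> order r A"
    using order_mult[OF ne'] by simp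
  ultimately show False using eq by simp
qed

lemma card_roots_rsquarefree:
  fixes p :: "complex poly"
  assumes "rsquarefree p"
  shows "card {z. poly p z = 0} = degree p"
proof -
  have "p \<noteq> 0" using assms by (auto simp: rsquarefree_def)
  have "degree p = degree (smult (lead_coeff p) (\<Prod>z|poly p z = 0. [:-z, 1:]))"
    by (simp only: complex_poly_decompose_rsquarefree[OF assms])
  also have "\<dots> = card {z. poly p z = 0}"
    using \<open>p \<noteq> 0\<close> by (simp add: degree_prod_sum_eq)
  finally show ?thesis by simp
qed

text \<open>
  The rational function \<open>A / B\<close> has \<open>max (degree A) (degree B)\<close> points
  in almost every fibre: a multiple root of \<open>A - \<kappa> B\<close> is a root of the
  Wronskian of \<open>A\<close> and \<open>B\<close>, so it occurs for finitely many
  \<open>\<kappa>\<close> only.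
\<close>

lemma cofinite_fibre_card:
  fixes A B :: "complex poly"
  assumes nc: "\<And>t. poly A t = 0 \<Longrightarrow> poly B t \<noteq> 0" and pos: "max (degree A) (degree B) > 0"
  shows "finite {\<kappa>. card {t. poly A t = \<kappa> * poly B t} \<noteq> max (degree A) (degree B)}"
proof -
  define W where "W = pderiv A * B - A * pderiv B"
  have "W \<noteq> 0"
  proof (cases "degree A > 0")
    case True
    then show ?thesis using wronskian_nonzero[of A B] nc by (auto simp: W_def)
  next
    case False
    then have "pderiv B * A \<noteq> B * pderiv A"
      using nc pos by (intro wronskian_nonzero) auto
    then show ?thesis by (auto simp: W_def mult.commute)
  qed
  then have fW: "finite {t. poly W t = 0}" by (simp add: poly_roots_finite)
  have "{\<kappa>. card {t. poly A t = \<kappa> * poly B t} \<noteq> max (degree A) (degree B)} \<subseteq>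
     {\<kappa>. degree (A - smult \<kappa> B) \<noteq> max (degree A) (degree B)} \<union>
     (\<lambda>t. poly A t / poly B t) ` {t. poly W t = 0}" (is "?L \<subseteq> ?D \<union> ?E")
  proof
    fix \<kappa> assume k: "\<kappa> \<in> ?L"
    show "\<kappa> \<in> ?D \<union> ?E"
    proof (rule ccontr)
      assume n: "\<kappa> \<notin> ?D \<union> ?E"
      define p where "p = A - smult \<kappa> B"
      have deg: "degree p = max (degree A) (degree B)" using n by (simp add: p_def)
      have "p \<noteq> 0" using deg pos by auto
      have "\<not> (poly p t = 0 \<and> poly (pderiv p) t = 0)" for t
      proof
        assume h: "poly p t = 0 \<and> poly (pderiv p) t = 0"
        then have 1: "poly A t = \<kappa> * poly B t" by (simp add: p_def)
        have 2: "poly (pderiv A) t = \<kappa> * poly (pderiv B) t"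
          using h by (simp add: p_def pderiv_diff pderiv_smult)
        have "poly B t \<noteq> 0" using 1 nc by auto
        moreover have "poly W t = 0" using 1 2 by (simp add: W_def)
        ultimately have "\<kappa> \<in> ?E" using 1 by (auto simp: image_iff intro!: exI[of _ t])
        then show False using n by simp
      qed
      then have "rsquarefree p" by (simp add: rsquarefree_roots)
      then have "card {t. poly p t = 0} = degree p"
        by (rule card_roots_rsquarefree)
      then show False using k deg by (simp add: p_def)
    qed
  qed
  then show ?thesis
    using fW cofinite_degree_pencil[of A B] by (meson finite_UnI finite_imageI finite_subset)
qed

text \<open>
  The curve \<open>X\<^sup>v = Y\<^sup>u\<close> is parameterized by \<open>s \<mapsto>
  (s\<^sup>u, s\<^sup>v)\<close>; a Bezout relation recovers \<open>s\<close> as a monomial in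
  \<open>X\<close> and \<open>Y\<close>.
\<close>

lemma common_root_of_powers:
  fixes X Y :: complex
  assumes "coprime u v" "u > 0" "X \<noteq> 0" "Y \<noteq> 0" "X ^ v = Y ^ u"
  obtains s where "X = s ^ u" "Y = s ^ v"
proof -
  obtain a b where ab: "u * a = v * b + 1"
    using bezout_nat[of u v] assms by auto
  define s where "s = X ^ a / Y ^ b"
  have "s ^ u = X ^ (u * a) / Y ^ (u * b)"
    by (simp add: s_def power_divide flip: power_mult add: mult.commute)
  also have "Y ^ (u * b) = X ^ (v * b)" by (simp add: power_mult assms(5))
  also have "X ^ (u * a) / X ^ (v * b) = X" using assms by (simp add: ab)
  finally have 1: "X = s ^ u" by simp
  have "s ^ v = X ^ (v * a) / Y ^ (v * b)"
    by (simp add: s_def power_divide flip: power_mult add: mult.commute)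
  also have "X ^ (v * a) = Y ^ (u * a)" by (simp add: power_mult assms(5))
  also have "Y ^ (u * a) / Y ^ (v * b) = Y" using assms by (simp add: ab)
  finally have "Y = s ^ v" by simp
  with 1 that show ?thesis by blast
qed

section \<open>Substitution of a monomial arc\<close>

definition support :: "complex poly poly \<Rightarrow> (nat \<times> nat) set" where
  "support \<phi> = {(i, j). coeff (coeff \<phi> j) i \<noteq> 0}"

lemma finite_support: "finite (support \<phi>)"
proof (rule finite_subset)
  show "support \<phi> \<subseteq> (\<Union>j\<le>degree \<phi>. (\<lambda>i. (i, j)) ` {..degree (coeff \<phi> j)})"
    by (force simp: support_def image_iff intro: le_degree)
qed simp

lemma support_eq_empty_iff: "support \<phi> = {} \<longleftrightarrow> \<phi> = 0"
  by (auto simp: support_def poly_eq_iff)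

lemma eval2_support:
  "eval2 \<phi> (x, y) = (\<Sum>(i, j)\<in>support \<phi>. coeff (coeff \<phi> j) i * x ^ i * y ^ j)"
proof -
  define d where "d = Max (insert 0 ((\<lambda>j. degree (coeff \<phi> j)) ` {..degree \<phi>}))"
  have d: "degree (coeff \<phi> j) \<le> d" if "j \<le> degree \<phi>" for j
    using that unfolding d_def by (intro Max_ge) auto
  have p: "poly (coeff \<phi> j) x = (\<Sum>i\<le>d. coeff (coeff \<phi> j) i * x ^ i)" if "j \<le> degree \<phi>" for j
  proof -
    have "poly (coeff \<phi> j) x = (\<Sum>i\<le>degree (coeff \<phi> j). coeff (coeff \<phi> j) i * x ^ i)"
      by (rule poly_altdef)
    also have "\<dots> = (\<Sum>i\<le>d. coeff (coeff \<phi> j) i * x ^ i)"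
      using d[OF that] by (intro sum.mono_neutral_left) (auto simp: coeff_eq_0)
    finally show ?thesis .
  qed
  have "eval2 \<phi> (x, y) = (\<Sum>j\<le>degree \<phi>. poly (coeff \<phi> j) x * y ^ j)"
    by (simp add: eval2_def poly_altdef[of \<phi>] poly_sum poly_power)
  also have "\<dots> = (\<Sum>j\<le>degree \<phi>. \<Sum>i\<le>d. coeff (coeff \<phi> j) i * x ^ i * y ^ j)"
    by (rule sum.cong) (auto simp: p sum_distrib_right)
  also have "\<dots> = (\<Sum>i\<le>d. \<Sum>j\<le>degree \<phi>. coeff (coeff \<phi> j) i * x ^ i * y ^ j)"
    by (rule sum.swap)
  also have "\<dots> = (\<Sum>(i, j)\<in>{..d} \<times> {..degree \<phi>}. coeff (coeff \<phi> j) i * x ^ i * y ^ j)"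
    by (simp add: sum.cartesian_product)
  also have "\<dots> = (\<Sum>(i, j)\<in>support \<phi>. coeff (coeff \<phi> j) i * x ^ i * y ^ j)"
  proof (rule sum.mono_neutral_right)
    show "support \<phi> \<subseteq> {..d} \<times> {..degree \<phi>}"
    proof (clarsimp simp: support_def)
      fix i j assume nz: "coeff (coeff \<phi> j) i \<noteq> 0"
      then have "j \<le> degree \<phi>" by (metis coeff_0 le_degree)
      moreover have "i \<le> degree (coeff \<phi> j)" using nz by (rule le_degree)
      ultimately show "i \<le> d \<and> j \<le> degree \<phi>" using d[of j] by simp
    qed
  qed (auto simp: support_def)
  finally show ?thesis .
qed

definition subst2 :: "complex poly poly \<Rightarrow> complex poly \<Rightarrow> complex poly \<Rightarrow> complex poly" where
  "subst2 \<phi> p q = (\<Sum>(i, j)\<in>support \<phi>. smult (coeff (coeff \<phi> j) i) (p ^ i * q ^ j))"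

lemma poly_subst2: "poly (subst2 \<phi> p q) s = eval2 \<phi> (poly p s, poly q s)"
  by (simp add: subst2_def eval2_support poly_sum case_prod_unfold mult.assoc)

lemma subst2_mult: "subst2 (\<phi> * \<psi>) p q = subst2 \<phi> p q * subst2 \<psi> p q"
  by (subst poly_eq_poly_eq_iff[symmetric]) (auto simp: fun_eq_iff poly_subst2 eval2_def)

text \<open>
  The support function of the Newton polygon of \<open>\<phi>\<close> at \<open>(u, v)\<close>.
\<close>

definition weighted_degree :: "nat \<Rightarrow> nat \<Rightarrow> complex poly poly \<Rightarrow> nat" where
  "weighted_degree u v \<phi> = Max ((\<lambda>(i, j). u * i + v * j) ` support \<phi>)"

definition arc :: "complex \<Rightarrow> complex \<Rightarrow> nat \<Rightarrow> complex poly" where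
  "arc \<xi> \<kappa> u = [:\<xi>:] + monom \<kappa> u"

lemma poly_arc [simp]: "poly (arc \<xi> \<kappa> u) s = \<xi> + \<kappa> * s ^ u"
  by (simp add: arc_def poly_monom)

lemma degree_arc: "u > 0 \<Longrightarrow> \<kappa> \<noteq> 0 \<Longrightarrow> degree (arc \<xi> \<kappa> u) = u"
  unfolding arc_def by (subst degree_add_eq_right) (auto simp: degree_monom_eq)

lemma lead_coeff_arc: "u > 0 \<Longrightarrow> \<kappa> \<noteq> 0 \<Longrightarrow> lead_coeff (arc \<xi> \<kappa> u) = \<kappa>"
  by (simp add: degree_arc) (simp add: arc_def coeff_pCons split: nat.splits)

lemma degree_subst2_arc:
  assumes "u > 0" "v > 0" "\<kappa> \<noteq> 0"
  shows "degree (subst2 \<phi> (arc \<xi> \<kappa> u) (arc \<eta> 1 v)) \<le> weighted_degree u v \<phi>"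
proof -
  let ?p = "arc \<xi> \<kappa> u" and ?q = "arc \<eta> 1 v"
  show ?thesis unfolding subst2_def
  proof (rule degree_sum_le[OF finite_support], clarify)
    fix i j assume ij: "(i, j) \<in> support \<phi>"
    have "degree (smult (coeff (coeff \<phi> j) i) (?p ^ i * ?q ^ j)) \<le> degree (?p ^ i) + degree (?q ^ j)"
      by (meson degree_mult_le degree_smult_le order_trans)
    also have "\<dots> \<le> u * i + v * j"
      using degree_power_le[of ?p i] degree_power_le[of ?q j] assms by (simp add: degree_arc)
    also have "\<dots> \<le> weighted_degree u v \<phi>"
      unfolding weighted_degree_def using ij finite_support by (intro Max_ge) force+
    finally show "degree (smult (coeff (coeff \<phi> j) i) (?p ^ i * ?q ^ j)) \<le> weighted_degree u v \<phi>" .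
  qed
qed

text \<open>
  The coefficient of the expected top power of \<open>s\<close> is the sum of the \<open>coeff
  (coeff \<phi> j) i * \<kappa>\<^sup>i\<close> over the monomials of maximal weight. These have
  different exponents \<open>i\<close>, since \<open>v > 0\<close>, so the sum is a nonzero
  polynomial in \<open>\<kappa>\<close>.
\<close>

lemma cofinite_degree_subst2_arc:
  assumes "u > 0" "v > 0" "\<phi> \<noteq> 0"
  shows "finite {\<kappa>. degree (subst2 \<phi> (arc \<xi> \<kappa> u) (arc \<eta> 1 v)) \<noteq> weighted_degree u v \<phi>}"
proof -
  define h where "h = weighted_degree u v \<phi>"
  define T where "T = {(i, j) \<in> support \<phi>. u * i + v * j = h}"
  \<comment> \<open>the coefficient at the top weight as a polynomial in \<open>\<kappa>\<close>\<close>
  define f where "f = (\<Sum>(i, j)\<in>T. monom (coeff (coeff \<phi> j) i) i)"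
  have "h \<in> (\<lambda>(i, j). u * i + v * j) ` support \<phi>"
    unfolding h_def weighted_degree_def using finite_support assms
    by (intro Max_in) (auto simp: support_eq_empty_iff)
  then obtain i0 j0 where ij0: "(i0, j0) \<in> T" by (auto simp: T_def)
  have finT: "finite T" unfolding T_def by (rule finite_subset[OF _ finite_support]) auto
  have "coeff f i0 = (\<Sum>(i, j)\<in>T. if i = i0 then coeff (coeff \<phi> j) i else 0)"
    by (simp add: f_def coeff_sum case_prod_unfold)
  also have "\<dots> = (\<Sum>(i, j)\<in>{(i0, j0)}. coeff (coeff \<phi> j) i)"
    using ij0 \<open>v > 0\<close> finT
    by (intro sum.mono_neutral_cong_right) (auto simp: T_def split: if_splits)
  also have "\<dots> \<noteq> 0" using ij0 by (simp add: T_def support_def)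
  finally have "f \<noteq> 0" by auto
  have "coeff (subst2 \<phi> (arc \<xi> \<kappa> u) (arc \<eta> 1 v)) h = poly f \<kappa>" if "\<kappa> \<noteq> 0" for \<kappa>
  proof -
    let ?p = "arc \<xi> \<kappa> u" and ?q = "arc \<eta> 1 v"
    have nz: "?p \<noteq> 0" "?q \<noteq> 0" using lead_coeff_arc[of u \<kappa> \<xi>] lead_coeff_arc[of v 1 \<eta>] assms that by auto
    have deg: "degree (?p ^ i * ?q ^ j) = u * i + v * j" for i j
      using nz assms that by (simp add: degree_mult_eq degree_power_eq degree_arc)
    have lc: "lead_coeff (?p ^ i * ?q ^ j) = \<kappa> ^ i" for i j
      unfolding lead_coeff_mult lead_coeff_power using assms that by (simp add: lead_coeff_arc)
    have "coeff (?p ^ i * ?q ^ j) h = (if u * i + v * j = h then \<kappa> ^ i else 0)" if "(i, j) \<in> support \<phi>" for i j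
    proof (cases "u * i + v * j = h")
      case True
      then show ?thesis using lc[of i j] deg[of i j] by simp
    next
      case False
      have "u * i + v * j \<le> h"
        unfolding h_def weighted_degree_def using that finite_support by (intro Max_ge) force+
      then show ?thesis using False by (simp add: coeff_eq_0 deg)
    qed
    then have "coeff (subst2 \<phi> ?p ?q) h =
        (\<Sum>(i, j)\<in>support \<phi>. coeff (coeff \<phi> j) i * (if u * i + v * j = h then \<kappa> ^ i else 0))"
      by (auto simp: subst2_def coeff_sum intro!: sum.cong)
    also have "\<dots> = (\<Sum>(i, j)\<in>T. coeff (coeff \<phi> j) i * \<kappa> ^ i)"
      by (rule sum.mono_neutral_cong_right) (auto simp: T_def finite_support split: if_splits)
    also have "\<dots> = poly f \<kappa>" by (simp add: f_def poly_sum poly_monom case_prod_unfold)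
    finally show ?thesis .
  qed
  then have "{\<kappa>. degree (subst2 \<phi> (arc \<xi> \<kappa> u) (arc \<eta> 1 v)) \<noteq> h} \<subseteq> {0} \<union> {\<kappa>. poly f \<kappa> = 0}"
    using degree_subst2_arc[OF assms(1,2)] by (fastforce simp: h_def intro!: antisym le_degree)
  then show ?thesis using \<open>f \<noteq> 0\<close> poly_roots_finite finite_subset unfolding h_def by fastforce
qed

section \<open>The support function of the Newton polygon\<close>

lemma no_common_root_of_coprime:
  fixes p q :: "complex poly"
  assumes "coprime p q" "poly p t = 0" shows "poly q t \<noteq> 0"
proof
  assume "poly q t = 0"
  then have "[:-t, 1:] dvd p" "[:-t, 1:] dvd q" using assms by (simp_all add: poly_eq_0_iff_dvd)
  then have "is_unit [:-t, 1:]" using assms(1) coprime_common_divisor by blast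
  then show False by (simp add: is_unit_iff_degree)
qed

text \<open>
  The coordinates have poles of orders \<open>\<alpha>\<close> and \<open>\<beta>\<close> at
  \<open>t = 0\<close>, either of which may be zero, and no common pole elsewhere on the affine
  line.
\<close>

locale proper_parametrization =
  fixes F :: "part \<Rightarrow> complex poly" and \<alpha> \<beta> :: nat and q0 q1 :: "complex poly"
  assumes coprime0: "coprime (F P0) (F Q0)" and coprime1: "coprime (F P1) (F Q1)"
    and proper: "has_param_degree F 1"
    and Q0_eq: "F Q0 = monom 1 \<alpha> * q0" and Q1_eq: "F Q1 = monom 1 \<beta> * q1"
    and q0_0: "poly q0 0 \<noteq> 0" and q1_0: "poly q1 0 \<noteq> 0"
    and no_common_pole: "\<And>t. poly q0 t = 0 \<Longrightarrow> poly q1 t \<noteq> 0"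
    and deg0: "max (degree (F P0)) (degree (F Q0)) > 0"
    and deg1: "max (degree (F P1)) (degree (F Q1)) > 0"
begin

abbreviation "n \<equiv> max (degree (F P0)) (degree (F Q0))"
abbreviation "m \<equiv> max (degree (F P1)) (degree (F Q1))"

definition shift0 :: "complex \<Rightarrow> complex poly" where "shift0 \<xi> = F P0 - smult \<xi> (F Q0)"
definition shift1 :: "complex \<Rightarrow> complex poly" where "shift1 \<eta> = F P1 - smult \<eta> (F Q1)"

text \<open>
  The last condition makes \<open>x(t) - \<xi>\<close> and \<open>y(t) - \<eta>\<close> vanish at
  different parameters, so that the only factors common to the two products below come from poles.
\<close>

definition general :: "complex \<Rightarrow> complex \<Rightarrow> bool" where
  "general \<xi> \<eta> \<longleftrightarrow> degree (shift0 \<xi>) = n \<and> degree (shift1 \<eta>) = m \<and>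
     (\<forall>t. poly (shift0 \<xi>) t = 0 \<longrightarrow> poly (shift1 \<eta>) t \<noteq> 0)"

lemma Q_nonzero: "F Q0 \<noteq> 0" "F Q1 \<noteq> 0" "q0 \<noteq> 0" "q1 \<noteq> 0"
  using q0_0 q1_0 by (auto simp: Q0_eq Q1_eq)

lemma finite_not_dom: "finite (- param_dom F)"
proof -
  have "- param_dom F = {t. poly (F Q0) t = 0} \<union> {t. poly (F Q1) t = 0}"
    by (auto simp: param_dom_def)
  then show ?thesis using Q_nonzero by (simp add: poly_roots_finite)
qed

lemma shift_no_common_root:
  "poly (shift0 \<xi>) t = 0 \<Longrightarrow> poly (F Q0) t \<noteq> 0"
  "poly (shift1 \<eta>) t = 0 \<Longrightarrow> poly (F Q1) t \<noteq> 0"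
  using no_common_root_of_coprime[OF coprime0] no_common_root_of_coprime[OF coprime1]
  by (auto simp: shift0_def shift1_def)

text \<open>
  Each condition on \<open>\<xi>\<close>, and then each condition on \<open>\<eta>\<close> for
  this \<open>\<xi>\<close>, excludes finitely many values: the images of the finitely many zeros
  of \<open>x(t) - \<xi>\<close> under \<open>y\<close> are avoided by \<open>\<eta>\<close>.
\<close>

lemma exists_general:
  assumes "\<phi> \<noteq> 0"
  obtains \<xi> \<eta> where "general \<xi> \<eta>" "eval2 \<phi> (\<xi>, \<eta>) \<noteq> 0"
proof -
  have "finite ({\<xi>. degree (shift0 \<xi>) \<noteq> n} \<union> {\<xi>. poly (lead_coeff \<phi>) \<xi> = 0})"
    using cofinite_degree_pencil[of "F P0" "F Q0"] assms
    by (simp add: shift0_def poly_roots_finite)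
  then obtain \<xi> where \<xi>: "degree (shift0 \<xi>) = n" "poly (lead_coeff \<phi>) \<xi> \<noteq> 0"
    by (atomize_elim) (drule ex_new_if_finite[OF infinite_UNIV_char_0], blast)
  define f where "f = map_poly (\<lambda>a. poly a \<xi>) \<phi>"
  have ev: "poly f \<eta> = eval2 \<phi> (\<xi>, \<eta>)" for \<eta>
  proof -
    have "poly (map_poly (\<lambda>a. poly a \<xi>) p) \<eta> = eval2 p (\<xi>, \<eta>)" for p
      by (induction p) (auto simp: eval2_def map_poly_pCons)
    then show ?thesis by (simp add: f_def)
  qed
  have "coeff f (degree \<phi>) \<noteq> 0" using \<xi> by (simp add: f_def coeff_map_poly)
  then have "f \<noteq> 0" by auto
  have s0: "shift0 \<xi> \<noteq> 0" using \<xi> deg0 by auto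
  have "finite ({\<eta>. degree (shift1 \<eta>) \<noteq> m} \<union> {\<eta>. poly f \<eta> = 0} \<union>
      (\<lambda>t. poly (F P1) t / poly (F Q1) t) ` {t. poly (shift0 \<xi>) t = 0})"
    using cofinite_degree_pencil[of "F P1" "F Q1"] \<open>f \<noteq> 0\<close> s0
    by (simp add: shift1_def poly_roots_finite)
  then obtain \<eta> where \<eta>: "degree (shift1 \<eta>) = m" "poly f \<eta> \<noteq> 0"
      "\<eta> \<notin> (\<lambda>t. poly (F P1) t / poly (F Q1) t) ` {t. poly (shift0 \<xi>) t = 0}"
    by (atomize_elim) (drule ex_new_if_finite[OF infinite_UNIV_char_0], blast)
  have "poly (shift1 \<eta>) t \<noteq> 0" if t: "poly (shift0 \<xi>) t = 0" for t
  proof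
    assume 0: "poly (shift1 \<eta>) t = 0"
    then have "poly (F Q1) t \<noteq> 0" by (rule shift_no_common_root)
    then have "\<eta> = poly (F P1) t / poly (F Q1) t" using 0 by (simp add: shift1_def field_simps)
    then show False using \<eta>(3) t by auto
  qed
  then have "general \<xi> \<eta>" using \<xi> \<eta> by (auto simp: general_def)
  moreover have "eval2 \<phi> (\<xi>, \<eta>) \<noteq> 0" using \<eta> ev by simp
  ultimately show ?thesis using that by blast
qed

end

locale proper_parametrization_direction = proper_parametrization +
  fixes \<xi> \<eta> :: complex and u v :: nat
  assumes gen: "general \<xi> \<eta>" and u_pos: "u > 0" and v_pos: "v > 0" and coprime_uv: "coprime u v"
begin

definition common_order :: nat where "common_order = min (u * \<beta>) (v * \<alpha>)"

text \<open>
  \<open>A / B\<close> is the function \<open>(x - \<xi>)\<^sup>v / (y - \<eta>)\<^sup>u\<close>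
  on the parameter line in lowest terms.
\<close>

definition A :: "complex poly" where "A = shift0 \<xi> ^ v * (q1 ^ u * monom 1 (u * \<beta> - common_order))"
definition B :: "complex poly" where "B = shift1 \<eta> ^ u * (q0 ^ v * monom 1 (v * \<alpha> - common_order))"

definition height :: nat where
  "height = max (v * n + u * degree (F Q1)) (u * m + v * degree (F Q0)) - common_order"

lemma shift_nonzero: "shift0 \<xi> \<noteq> 0" "shift1 \<eta> \<noteq> 0"
  using gen deg0 deg1 by (auto simp: general_def)

lemma degree_Q: "degree (F Q0) = \<alpha> + degree q0" "degree (F Q1) = \<beta> + degree q1"
  using Q_nonzero by (simp_all add: Q0_eq Q1_eq degree_mult_eq degree_monom_eq)

text \<open>
  The power of \<open>t\<close> that the two products have in common at a shared pole at
  \<open>0\<close> is exactly what reduces the degree of the quotient.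
\<close>

lemma max_degree_AB: "max (degree A) (degree B) = height"
proof -
  have common_order: "common_order \<le> u * \<beta>" "common_order \<le> v * \<alpha>" by (simp_all add: common_order_def)
  have "degree A = v * n + (u * degree q1 + (u * \<beta> - common_order))" "degree B = u * m + (v * degree q0 + (v * \<alpha> - common_order))"
    using shift_nonzero Q_nonzero gen
    by (simp_all add: A_def B_def degree_mult_eq degree_power_eq degree_monom_eq general_def)
  then have "degree A = v * n + u * degree (F Q1) - common_order" "degree B = u * m + v * degree (F Q0) - common_order"
    using common_order unfolding degree_Q by (simp_all add: distrib_left)
  then show ?thesis unfolding height_def by (auto simp: max_def)
qed

lemma height_pos: "height > 0"
proof -
  have "common_order \<le> u * degree (F Q1)" by (simp add: common_order_def degree_Q min.coboundedI1)
  moreover have "v * n > 0" using v_pos deg0 by simp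
  ultimately have "common_order < v * n + u * degree (F Q1)" by linarith
  then show ?thesis unfolding height_def by (simp only: zero_less_diff less_max_iff_disj) simp
qed

text \<open>
  General \<open>\<xi>\<close> and \<open>\<eta>\<close> separate the zeros of \<open>x -
  \<xi>\<close> from those of \<open>y - \<eta>\<close>, coprimality separates the zeros of each
  function from its poles, and the remaining powers of \<open>t\<close> cannot both be positive.
\<close>

lemma AB_no_common_root: assumes "poly A t = 0" shows "poly B t \<noteq> 0"
proof
  assume B0: "poly B t = 0"
  have A: "poly (shift0 \<xi>) t = 0 \<or> poly q1 t = 0 \<or> (t = 0 \<and> u * \<beta> - common_order > 0)"
    using assms by (auto simp: A_def poly_monom)
  have B: "poly (shift1 \<eta>) t = 0 \<or> poly q0 t = 0 \<or> (t = 0 \<and> v * \<alpha> - common_order > 0)"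
    using B0 by (auto simp: B_def poly_monom)
  have 1: "\<not> (poly (shift0 \<xi>) t = 0 \<and> poly (shift1 \<eta>) t = 0)" using gen by (auto simp: general_def)
  have Q: "poly (F Q0) t = t ^ \<alpha> * poly q0 t" "poly (F Q1) t = t ^ \<beta> * poly q1 t"
    by (simp_all add: Q0_eq Q1_eq poly_monom)
  have 2: "poly (F Q0) t = 0" if "t = 0 \<and> v * \<alpha> - common_order > 0"
    using that Q by (cases "\<alpha> = 0") auto
  have 3: "poly (F Q1) t = 0" if "t = 0 \<and> u * \<beta> - common_order > 0"
    using that Q by (cases "\<beta> = 0") auto
  have 4: "\<not> (u * \<beta> - common_order > 0 \<and> v * \<alpha> - common_order > 0)" by (auto simp: common_order_def)
  have 5: "poly q0 t = 0 \<Longrightarrow> poly (F Q0) t = 0" "poly q1 t = 0 \<Longrightarrow> poly (F Q1) t = 0"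
    by (simp_all add: Q0_eq Q1_eq)
  have 6: "\<not> (poly q0 t = 0 \<and> poly q1 t = 0)" using no_common_pole by blast
  have 7: "\<not> (poly (shift0 \<xi>) t = 0 \<and> poly (F Q0) t = 0)" "\<not> (poly (shift1 \<eta>) t = 0 \<and> poly (F Q1) t = 0)"
    using shift_no_common_root by blast+
  have 8: "\<not> (poly q0 t = 0 \<and> t = 0)" "\<not> (poly q1 t = 0 \<and> t = 0)" using q0_0 q1_0 by auto
  show False
    using A B 1 2 3 4 5 6 7 8 by argo
qed

lemma AB_times_gcd:
  "shift0 \<xi> ^ v * F Q1 ^ u = monom 1 common_order * A" "shift1 \<eta> ^ u * F Q0 ^ v = monom 1 common_order * B"
proof -
  have [simp]: "(monom 1 k :: complex poly) ^ l = monom 1 (l * k)" for k l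
    by (simp add: monom_power mult.commute)
  have "monom (1::complex) (u * \<beta>) = monom 1 common_order * monom 1 (u * \<beta> - common_order)"
    by (simp add: mult_monom common_order_def)
  then show "shift0 \<xi> ^ v * F Q1 ^ u = monom 1 common_order * A"
    by (simp add: A_def Q1_eq power_mult_distrib mult_ac)
  have "monom (1::complex) (v * \<alpha>) = monom 1 common_order * monom 1 (v * \<alpha> - common_order)"
    by (simp add: mult_monom common_order_def)
  then show "shift1 \<eta> ^ u * F Q0 ^ v = monom 1 common_order * B"
    by (simp add: B_def Q0_eq power_mult_distrib mult_ac)
qed

abbreviation arc_subst :: "complex poly poly \<Rightarrow> complex \<Rightarrow> complex poly" where
  "arc_subst \<phi> \<kappa> \<equiv> subst2 \<phi> (arc \<xi> \<kappa> u) (arc \<eta> 1 v)"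

text \<open>
  Parameters in a general fibre of \<open>A / B\<close> lie over distinct points of the
  intersection of the curve with the arc, and these points are distinct roots of the substituted
  equation.
\<close>

lemma height_le_weighted_degree:
  assumes "\<phi> \<in> vanishing_ideal F" and nz: "eval2 \<phi> (\<xi>, \<eta>) \<noteq> 0"
  shows "height \<le> weighted_degree u v \<phi>"
proof -
  define bad where "bad = - param_dom F \<union>
     {t \<in> param_dom F. card {s \<in> param_dom F. param F s = param F t} \<noteq> 1} \<union>
     {t. poly (shift0 \<xi>) t = 0} \<union> {t. poly (shift1 \<eta>) t = 0}"
  have "finite bad"
    using finite_not_dom proper shift_nonzero
    by (simp add: bad_def has_param_degree_def poly_roots_finite)
  \<comment> \<open>a fibre of \<open>A / B\<close> over a value outside \<open>\<Omega>\<close> is reduced and avoids all exceptional parameters\<close>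
  define \<Omega> where "\<Omega> = insert 0 ((\<lambda>t. poly A t / poly B t) ` bad \<union>
     {\<kappa>. card {t. poly A t = \<kappa> * poly B t} \<noteq> height})"
  have "finite \<Omega>"
    unfolding \<Omega>_def max_degree_AB[symmetric]
    using \<open>finite bad\<close> AB_no_common_root height_pos max_degree_AB
    by (intro finite.insertI finite_UnI finite_imageI cofinite_fibre_card) auto
  have "finite {\<kappa>. \<kappa> ^ v \<in> \<Omega>}"
  proof -
    have "finite {\<kappa>. \<kappa> ^ v = c}" for c :: complex
    proof -
      have "coeff (monom 1 v - [:c:] :: complex poly) v = 1"
        using v_pos by (simp add: coeff_pCons split: nat.splits)
      then have "monom 1 v - [:c:] \<noteq> 0" by (metis coeff_0 zero_neq_one)
      then have "finite {\<kappa>. poly (monom 1 v - [:c:]) \<kappa> = 0}" by (rule poly_roots_finite)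
      then show ?thesis by (simp add: poly_monom)
    qed
    then have "finite (\<Union>c\<in>\<Omega>. {\<kappa>. \<kappa> ^ v = c})" using \<open>finite \<Omega>\<close> by simp
    then show ?thesis by (rule rev_finite_subset) auto
  qed
  then obtain \<kappa> where \<kappa>: "\<kappa> ^ v \<notin> \<Omega>"
    by (atomize_elim) (drule ex_new_if_finite[OF infinite_UNIV_char_0], blast)
  then have "\<kappa> \<noteq> 0" using v_pos by (auto simp: \<Omega>_def)
  define T where "T = {t. poly A t = \<kappa> ^ v * poly B t}"
  have cardT: "card T = height" using \<kappa> by (auto simp: T_def \<Omega>_def)
  have good: "t \<notin> bad" if "t \<in> T" for t
  proof
    assume "t \<in> bad"
    have "poly B t \<noteq> 0" using that AB_no_common_root by (auto simp: T_def)
    then have "\<kappa> ^ v = poly A t / poly B t" using that by (simp add: T_def)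
    then show False using \<kappa> \<open>t \<in> bad\<close> by (auto simp: \<Omega>_def)
  qed
  have "\<exists>s. param F t = (\<xi> + \<kappa> * s ^ u, \<eta> + s ^ v)" if t: "t \<in> T" for t
  proof -
    have ok: "poly (F Q0) t \<noteq> 0" "poly (F Q1) t \<noteq> 0" "poly (shift0 \<xi>) t \<noteq> 0" "poly (shift1 \<eta>) t \<noteq> 0"
      using good[OF t] by (auto simp: bad_def param_dom_def)
    define X where "X = poly (shift0 \<xi>) t / poly (F Q0) t / \<kappa>"
    define Y where "Y = poly (shift1 \<eta>) t / poly (F Q1) t"
    have "poly (shift0 \<xi> ^ v * F Q1 ^ u) t = \<kappa> ^ v * poly (shift1 \<eta> ^ u * F Q0 ^ v) t"
      using t by (simp add: AB_times_gcd T_def)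
    then have "X ^ v = Y ^ u"
      using ok \<open>\<kappa> \<noteq> 0\<close> by (simp add: X_def Y_def power_divide field_simps)
    moreover have "X \<noteq> 0" "Y \<noteq> 0" using ok \<open>\<kappa> \<noteq> 0\<close> by (simp_all add: X_def Y_def)
    ultimately obtain s where s: "X = s ^ u" "Y = s ^ v"
      using common_root_of_powers coprime_uv u_pos by metis
    have "poly (F P0) t / poly (F Q0) t = \<xi> + \<kappa> * X" "poly (F P1) t / poly (F Q1) t = \<eta> + Y"
      using ok \<open>\<kappa> \<noteq> 0\<close> by (simp_all add: X_def Y_def shift0_def shift1_def field_simps)
    then show ?thesis using s by (auto simp: param_def intro!: exI[of _ s])
  qed
  then obtain \<sigma> where \<sigma>: "\<And>t. t \<in> T \<Longrightarrow> param F t = (\<xi> + \<kappa> * \<sigma> t ^ u, \<eta> + \<sigma> t ^ v)"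
    by metis
  have "inj_on \<sigma> T"
  proof (rule inj_onI)
    fix t t' assume tt': "t \<in> T" "t' \<in> T" "\<sigma> t = \<sigma> t'"
    then have eq: "param F t = param F t'" using \<sigma> by simp
    have "card {s \<in> param_dom F. param F s = param F t} = 1"
      using good[OF tt'(1)] by (auto simp: bad_def)
    then obtain w where w: "{s \<in> param_dom F. param F s = param F t} = {w}" by (auto simp: card_1_singleton_iff)
    have "t \<in> param_dom F" "t' \<in> param_dom F" using good tt' by (auto simp: bad_def)
    then have "t \<in> {w}" "t' \<in> {w}" using eq unfolding w[symmetric] by auto
    then show "t = t'" by simp
  qed
  have p0: "poly (arc_subst \<phi> \<kappa>) 0 \<noteq> 0" using nz u_pos v_pos by (simp add: poly_subst2 zero_power)
  then have ne: "arc_subst \<phi> \<kappa> \<noteq> 0" by auto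
  have "\<sigma> ` T \<subseteq> {s. poly (arc_subst \<phi> \<kappa>) s = 0}"
  proof clarify
    fix t assume t: "t \<in> T"
    then have "t \<in> param_dom F" using good by (auto simp: bad_def)
    then show "poly (arc_subst \<phi> \<kappa>) (\<sigma> t) = 0"
      using assms(1) \<sigma>[OF t] by (auto simp: vanishing_ideal_def poly_subst2)
  qed
  then have "card (\<sigma> ` T) \<le> card {s. poly (arc_subst \<phi> \<kappa>) s = 0}"
    using ne by (intro card_mono poly_roots_finite)
  also have "\<dots> \<le> degree (arc_subst \<phi> \<kappa>)" using ne by (rule card_poly_roots_bound)
  also have "\<dots> \<le> weighted_degree u v \<phi>"
    using u_pos v_pos \<open>\<kappa> \<noteq> 0\<close> by (rule degree_subst2_arc)
  finally show ?thesis using \<open>inj_on \<sigma> T\<close> cardT by (simp add: card_image)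
qed


text \<open>
  The monomials in \<open>x - \<xi>\<close> and \<open>y - \<eta>\<close> considered here have
  weights in an interval of length \<open>height\<close>, and for each weight there are \<open>D +
  1\<close> of them, obtained from each other by multiplication with \<open>(x - \<xi>)\<^sup>v /
  (y - \<eta>)\<^sup>u\<close>. Along the parameterization each such step raises the degree in
  \<open>t\<close> by at most \<open>height\<close>. So there are \<open>(height + 1) (D +
  1)\<close> monomials against \<open>D * height + O(1)\<close> coefficients, and for large
  \<open>D\<close> some combination vanishes on the curve.
\<close>

lemma exists_vanishing_of_bounded_width:
  "\<exists>\<psi> M w. \<psi> \<in> vanishing_ideal F \<and> \<psi> \<noteq> 0 \<and>
     (\<forall>\<kappa>. arc_subst \<psi> \<kappa> = monom 1 M * w \<kappa> \<and> degree (w \<kappa>) \<le> height) \<and>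
     finite {\<kappa>. w \<kappa> = 0}"
proof -
  let ?H = height
  obtain a b where ab: "u * a = v * b + 1"
    using bezout_nat[of u v] coprime_uv u_pos by auto
  \<comment> \<open>large enough for the unknowns to outnumber the coefficients\<close>
  define D where "D = ?H * (a * n + b * m) + 1"
  define I where "I = {..?H} \<times> {..D}"
  define ex where "ex = (\<lambda>(r, k). v * k + r * a)"
  define ey where "ey = (\<lambda>(r, k). u * (D - k) + (?H - r) * b)"
  define G where "G = (\<lambda>(r, k). A ^ k * B ^ (D - k) *
    (shift0 \<xi> ^ (r * a) * F Q0 ^ ((?H - r) * a) * (shift1 \<eta> ^ ((?H - r) * b) * F Q1 ^ (r * b))))"
  have finI: "finite I" by (simp add: I_def)
  have wt: "u * ex i + v * ey i = (u * v * D + v * b * ?H) + fst i" if "i \<in> I" for i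
  proof -
    obtain r k where [simp]: "i = (r, k)" by (cases i)
    have le: "k \<le> D" "r \<le> ?H" using that by (auto simp: I_def)
    have "u * ex i = u * v * k + r * (u * a)" by (simp add: ex_def distrib_left)
    also have "u * a = v * b + 1" by (rule ab)
    finally have "u * ex i = u * v * k + r * (v * b + 1)" .
    moreover have "v * ey i = u * v * (D - k) + v * b * (?H - r)"
      by (simp add: ey_def distrib_left)
    moreover have "u * v * k + u * v * (D - k) = u * v * D" "v * b * r + v * b * (?H - r) = v * b * ?H"
      using le by (simp_all flip: distrib_left)
    ultimately show ?thesis by (simp add: distrib_left mult_ac)
  qed
  have degG: "degree (G i) \<le> D * ?H + ?H * (a * n + b * m)" if "i \<in> I" for i
  proof -
    obtain r k where [simp]: "i = (r, k)" by (cases i)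
    have le: "k \<le> D" "r \<le> ?H" using that by (auto simp: I_def)
    have d: "degree (p ^ l) \<le> l * e" if "degree p \<le> e" for p :: "complex poly" and l e
      by (rule order_trans[OF degree_power_le]) (metis that mult.commute mult_le_mono1)
    have "degree (G i) \<le> (k * ?H + (D - k) * ?H) +
      ((r * a) * n + ((?H - r) * a) * n + (((?H - r) * b) * m + (r * b) * m))"
      unfolding G_def \<open>i = (r, k)\<close> prod.case
      using max_degree_AB gen
      by (intro order_trans[OF degree_mult_le] add_mono d) (auto simp: general_def)
    also have "k * ?H + (D - k) * ?H = D * ?H" using le by (simp flip: distrib_right)
    also have "(r * a) * n + ((?H - r) * a) * n + (((?H - r) * b) * m + (r * b) * m)
        = (r + (?H - r)) * (a * n + b * m)"
      by (simp add: distrib_right distrib_left)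
    also have "\<dots> = ?H * (a * n + b * m)" using le by simp
    finally show ?thesis by simp
  qed
  have "card I = (?H + 1) * (D + 1)" by (simp add: I_def)
  then have "card I > D * ?H + ?H * (a * n + b * m) + 1" by (simp add: D_def algebra_simps)
  moreover have "coeff (G i) k = 0" if "i \<in> I" "k \<ge> D * ?H + ?H * (a * n + b * m) + 1" for i k
    using degG[OF that(1)] that(2) by (intro coeff_eq_0) linarith
  ultimately obtain c where c: "\<exists>i\<in>I. c i \<noteq> 0" "(\<Sum>i\<in>I. smult (c i) (G i)) = 0"
    using linear_relation[OF finI, of "D * ?H + ?H * (a * n + b * m) + 1" G] by blast
  define \<psi> where "\<psi> = (\<Sum>i\<in>I. smult [:c i:] ([:[:-\<xi>, 1:]:] ^ ex i * [:[:-\<eta>:], 1:] ^ ey i))"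
  define w where "w \<kappa> = (\<Sum>i\<in>I. monom (c i * \<kappa> ^ ex i) (fst i))" for \<kappa>
  have ev: "eval2 \<psi> (x, y) = (\<Sum>i\<in>I. c i * (x - \<xi>) ^ ex i * (y - \<eta>) ^ ey i)" for x y
    by (simp add: \<psi>_def eval2_def poly_sum mult.assoc)
  have "eval2 \<psi> (param F t) = 0" if "t \<in> param_dom F" for t
  proof -
    have nz: "poly (F Q0) t \<noteq> 0" "poly (F Q1) t \<noteq> 0" using that by (auto simp: param_dom_def)
    \<comment> \<open>a common denominator of the monomials along the parameterization\<close>
    define R where "R = poly (F Q0) t ^ (v * D + ?H * a) * poly (F Q1) t ^ (u * D + ?H * b)"
    have "R * eval2 \<psi> (param F t) =
      (\<Sum>i\<in>I. t ^ (common_order * D) * (c i * poly (G i) t))"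
      unfolding param_def ev sum_distrib_left
    proof (rule sum.cong[OF refl])
      fix i assume i: "i \<in> I"
      obtain r k where [simp]: "i = (r, k)" by (cases i)
      obtain k' r' where kr: "D = k + k'" "?H = r + r'" using i by (auto simp: I_def le_iff_add)
      have kr': "D - k = k'" "?H - r = r'" using kr by auto
      let ?p0 = "poly (shift0 \<xi>) t" and ?p1 = "poly (shift1 \<eta>) t"
      let ?q0 = "poly (F Q0) t" and ?q1 = "poly (F Q1) t"
      have x: "poly (F P0) t / ?q0 - \<xi> = ?p0 / ?q0" "poly (F P1) t / ?q1 - \<eta> = ?p1 / ?q1"
        using nz by (simp_all add: shift0_def shift1_def field_simps)
      have AB: "?p0 ^ v * ?q1 ^ u = t ^ common_order * poly A t" "?p1 ^ u * ?q0 ^ v = t ^ common_order * poly B t"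
        using arg_cong[OF AB_times_gcd(1), of "\<lambda>p. poly p t"] arg_cong[OF AB_times_gcd(2), of "\<lambda>p. poly p t"]
        by (simp_all add: poly_monom)
      have X: "?q0 ^ (v * D + ?H * a) * (?p0 / ?q0) ^ ex i = ?p0 ^ (v * k + r * a) * ?q0 ^ (v * k' + r' * a)"
        using nz by (simp add: ex_def kr power_divide power_add distrib_left distrib_right)
      have Y: "?q1 ^ (u * D + ?H * b) * (?p1 / ?q1) ^ ey i = ?p1 ^ (u * k' + r' * b) * ?q1 ^ (u * k + r * b)"
        using nz by (simp add: ey_def kr' power_divide power_add distrib_left distrib_right)
          (simp add: kr power_add distrib_left distrib_right)
      have "R * (c i * (?p0 / ?q0) ^ ex i * (?p1 / ?q1) ^ ey i) =
          c i * (?q0 ^ (v * D + ?H * a) * (?p0 / ?q0) ^ ex i) * (?q1 ^ (u * D + ?H * b) * (?p1 / ?q1) ^ ey i)"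
        by (simp add: R_def mult_ac)
      also have "\<dots> = c i * ((?p0 ^ v * ?q1 ^ u) ^ k * (?p1 ^ u * ?q0 ^ v) ^ k') *
          (?p0 ^ (r * a) * ?q0 ^ (r' * a) * (?p1 ^ (r' * b) * ?q1 ^ (r * b)))"
        unfolding X Y by (simp add: power_add power_mult_distrib mult_ac flip: power_mult)
      also have "\<dots> = t ^ (common_order * D) * (c i * poly (G i) t)"
        unfolding AB by (simp add: G_def kr' power_mult_distrib mult_ac)
          (simp add: kr power_add distrib_left distrib_right mult_ac flip: power_mult)
      finally show "R * (c i * (poly (F P0) t / ?q0 - \<xi>) ^ ex i * (poly (F P1) t / ?q1 - \<eta>) ^ ey i) =
          t ^ (common_order * D) * (c i * poly (G i) t)" unfolding x .
    qed
    also have "\<dots> = t ^ (common_order * D) * poly (\<Sum>i\<in>I. smult (c i) (G i)) t"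
      by (simp add: poly_sum sum_distrib_left)
    also have "\<dots> = 0" by (simp add: c(2))
    finally show ?thesis using nz by (simp add: R_def)
  qed
  then have van: "\<psi> \<in> vanishing_ideal F" by (simp add: vanishing_ideal_def)
  have sub: "arc_subst \<psi> \<kappa> = monom 1 (u * v * D + v * b * ?H) * w \<kappa>" for \<kappa>
  proof (subst poly_eq_poly_eq_iff[symmetric], rule ext)
    fix s
    have "poly (arc_subst \<psi> \<kappa>) s = (\<Sum>i\<in>I. c i * \<kappa> ^ ex i * s ^ (u * ex i + v * ey i))"
      by (simp add: poly_subst2 ev power_mult_distrib power_add power_mult mult.assoc)
    also have "\<dots> = (\<Sum>i\<in>I. s ^ (u * v * D + v * b * ?H) * (c i * \<kappa> ^ ex i * s ^ fst i))"
      by (rule sum.cong) (simp_all add: wt power_add mult_ac)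
    finally show "poly (arc_subst \<psi> \<kappa>) s = poly (monom 1 (u * v * D + v * b * ?H) * w \<kappa>) s"
      by (simp add: w_def poly_monom poly_sum sum_distrib_left)
  qed
  have degw: "degree (w \<kappa>) \<le> ?H" for \<kappa>
    unfolding w_def
    by (rule degree_sum_le[OF finI]) (auto simp: I_def intro: order_trans[OF degree_monom_le])
  have fin: "finite {\<kappa>. w \<kappa> = 0}"
  proof -
    obtain r0 k0 where rk: "(r0, k0) \<in> I" "c (r0, k0) \<noteq> 0" using c(1) by auto
    define f where "f = (\<Sum>i\<in>{i \<in> I. fst i = r0}. monom (c i) (ex i))"
    have "coeff f (ex (r0, k0)) = (\<Sum>i\<in>{i \<in> I. fst i = r0}. if ex i = ex (r0, k0) then c i else 0)"
      by (simp add: f_def coeff_sum)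
    also have "\<dots> = (\<Sum>i\<in>{(r0, k0)}. c i)"
      using rk v_pos finI by (intro sum.mono_neutral_cong_right) (auto simp: ex_def split: if_splits)
    finally have "f \<noteq> 0" using rk by auto
    have "coeff (w \<kappa>) r0 = poly f \<kappa>" for \<kappa>
    proof -
      have "coeff (w \<kappa>) r0 = (\<Sum>i\<in>I. if fst i = r0 then c i * \<kappa> ^ ex i else 0)"
        by (simp add: w_def coeff_sum)
      also have "\<dots> = poly f \<kappa>"
        unfolding f_def using finI
        by (simp add: poly_sum poly_monom sum.inter_filter flip: sum.inter_filter)
      finally show ?thesis .
    qed
    then have "{\<kappa>. w \<kappa> = 0} \<subseteq> {\<kappa>. poly f \<kappa> = 0}" by (metis (mono_tags) Collect_mono coeff_0)
    then show ?thesis using \<open>f \<noteq> 0\<close> poly_roots_finite finite_subset by blast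
  qed
  have "\<psi> \<noteq> 0"
  proof
    assume "\<psi> = 0"
    then have "w \<kappa> = 0" for \<kappa> using sub[of \<kappa>] by (simp add: subst2_def support_def)
    then show False using fin infinite_UNIV_char_0[where 'a=complex] by simp
  qed
  then show ?thesis using van sub degw fin by blast
qed

text \<open>
  The substituted \<open>\<phi>\<close> divides \<open>s\<^sup>M * w\<close> and does not vanish
  at \<open>s = 0\<close>, so the factor \<open>s\<^sup>M\<close> belongs to the cofactor.
\<close>

lemma weighted_degree_le_height:
  assumes "implicit_equation F \<phi>" and nz: "eval2 \<phi> (\<xi>, \<eta>) \<noteq> 0"
  shows "weighted_degree u v \<phi> \<le> height"
proof -
  have "\<phi> \<noteq> 0" using nz by (auto simp: eval2_def)
  obtain \<psi> M w where \<psi>: "\<psi> \<in> vanishing_ideal F" "\<And>\<kappa>. arc_subst \<psi> \<kappa> = monom 1 M * w \<kappa>"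
      "\<And>\<kappa>. degree (w \<kappa>) \<le> height" and fin: "finite {\<kappa>. w \<kappa> = 0}"
    using exists_vanishing_of_bounded_width by metis
  obtain \<rho> where \<rho>: "\<psi> = \<phi> * \<rho>" using assms(1) \<psi>(1) by (auto simp: implicit_equation_def)
  have "finite ({\<kappa>. w \<kappa> = 0} \<union> {\<kappa>. degree (arc_subst \<phi> \<kappa>) \<noteq> weighted_degree u v \<phi>})"
    using fin cofinite_degree_subst2_arc[OF u_pos v_pos \<open>\<phi> \<noteq> 0\<close>] by simp
  then obtain \<kappa> where \<kappa>: "w \<kappa> \<noteq> 0" "degree (arc_subst \<phi> \<kappa>) = weighted_degree u v \<phi>"
    by (atomize_elim) (drule ex_new_if_finite[OF infinite_UNIV_char_0], blast)
  define f where "f = arc_subst \<phi> \<kappa>"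
  define h where "h = arc_subst \<rho> \<kappa>"
  have eq: "monom 1 M * w \<kappa> = f * h" using \<psi>(2)[of \<kappa>] by (simp add: \<rho> subst2_mult f_def h_def)
  have f0: "poly f 0 \<noteq> 0" using nz u_pos v_pos by (simp add: f_def poly_subst2 zero_power)
  have ne: "f * h \<noteq> 0" using eq \<kappa>(1) by (metis monom_eq_0_iff mult_eq_0_iff zero_neq_one)
  then have h0: "h \<noteq> 0" by auto
  have "M \<le> order 0 (f * h)"
  proof -
    have "[:-0, 1:] ^ M dvd f * h" unfolding eq[symmetric]
      by (simp add: monom_altdef)
    then show ?thesis using ne order_divides by blast
  qed
  also have "order 0 (f * h) = order 0 h" using order_mult[OF ne] f0 by (simp add: order_0I)
  also have "\<dots> \<le> degree h" using h0 by (rule order_degree)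
  finally have "M \<le> degree h" .
  moreover have "degree (f * h) = degree f + degree h" using f0 h0 by (intro degree_mult_eq) auto
  moreover have "degree (f * h) = M + degree (w \<kappa>)"
    unfolding eq[symmetric] using \<kappa>(1) by (subst degree_mult_eq) (auto simp: degree_monom_eq)
  ultimately show ?thesis using \<psi>(3)[of \<kappa>] \<kappa>(2) by (simp add: f_def)
qed

end

context proper_parametrization
begin

text \<open>
  The vanishing polynomials found for one general pair \<open>\<xi>, \<eta>\<close> show that
  \<open>\<phi> \<noteq> 0\<close>; only then can the pair be chosen off the curve, as the
  comparison of degrees requires.
\<close>

theorem weighted_degree_implicit_equation:
  assumes "implicit_equation F \<phi>" and "u > 0" "v > 0" "coprime u v"
  shows "\<phi> \<noteq> 0"
    and "weighted_degree u v \<phi> =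
      max (v * n + u * degree (F Q1)) (u * m + v * degree (F Q0)) - min (u * \<beta>) (v * \<alpha>)"
proof -
  obtain \<xi>' \<eta>' where "general \<xi>' \<eta>'" using exists_general[of 1] by (auto simp: eval2_def)
  then interpret d': proper_parametrization_direction F \<alpha> \<beta> q0 q1 \<xi>' \<eta>' u v
    by unfold_locales (use assms in auto)
  obtain \<psi> where "\<psi> \<in> vanishing_ideal F" "\<psi> \<noteq> 0"
    using d'.exists_vanishing_of_bounded_width by blast
  then show "\<phi> \<noteq> 0" using assms(1) by (auto simp: implicit_equation_def)
  then obtain \<xi> \<eta> where gen: "general \<xi> \<eta>" and nz: "eval2 \<phi> (\<xi>, \<eta>) \<noteq> 0"
    by (rule exists_general)
  interpret proper_parametrization_direction F \<alpha> \<beta> q0 q1 \<xi> \<eta> u v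
    by unfold_locales (use assms gen in auto)
  have "\<phi> \<in> vanishing_ideal F"
    using assms(1) by (auto simp: implicit_equation_def intro!: exI[of _ 1])
  then show "weighted_degree u v \<phi> =
      max (v * n + u * degree (F Q1)) (u * m + v * degree (F Q0)) - min (u * \<beta>) (v * \<alpha>)"
    using height_le_weighted_degree[OF _ nz] weighted_degree_le_height[OF assms(1) nz]
    unfolding height_def common_order_def by simp
qed

end

section \<open>Generic coefficients\<close>

lemma generically_conj:
  assumes "generically S R" "generically S R'"
  shows "generically S (\<lambda>c. R c \<and> R' c)"
proof -
  let ?X = "coeff_space S"
  obtain U where U: "openin ?X U" "?X closure_of U = topspace ?X" "\<And>c. c \<in> U \<Longrightarrow> R c"
    using assms(1) by (auto simp: generically_def)
  obtain V where V: "openin ?X V" "?X closure_of V = topspace ?X" "\<And>c. c \<in> V \<Longrightarrow> R' c"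
    using assms(2) by (auto simp: generically_def)
  have "(U \<inter> V) \<inter> T \<noteq> {}" if "openin ?X T" "T \<noteq> {}" for T
  proof -
    have "V \<inter> T \<noteq> {}" using V(2) that by (auto simp: dense_intersects_open)
    moreover have "openin ?X (V \<inter> T)" using V that by auto
    ultimately show ?thesis using U(2) unfolding dense_intersects_open by (metis inf_assoc)
  qed
  then have "?X closure_of (U \<inter> V) = topspace ?X" by (simp add: dense_intersects_open)
  then show ?thesis
    unfolding generically_def using U V by (intro exI[of _ "U \<inter> V"]) auto
qed

lemma generically_mono:
  assumes "generically S R" "\<And>c. R c \<Longrightarrow> R' c" shows "generically S R'"
  using assms by (auto simp: generically_def)

lemma generically_obtains:
  assumes "generically S R" obtains c where "R c"
proof -
  let ?X = "coeff_space S"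
  obtain U where U: "openin ?X U" "?X closure_of U = topspace ?X" "\<And>c. c \<in> U \<Longrightarrow> R c"
    using assms by (auto simp: generically_def)
  have "topspace ?X \<noteq> {}" by (auto simp: coeff_space_def PiE_eq_empty_iff)
  then have "U \<noteq> {}" using U(2) by (metis closure_of_empty)
  then show ?thesis using U(3) that by blast
qed

text \<open>
  The family polynomial divided by the highest power of \<open>t\<close> that its support allows.
\<close>

definition trimmed :: "(part \<Rightarrow> nat set) \<Rightarrow> (part \<times> nat \<Rightarrow> complex) \<Rightarrow> part \<Rightarrow> complex poly" where
  "trimmed S c p = (\<Sum>k\<in>S p. monom (c (p, k)) (k - Min (S p)))"

lemma poly_trimmed_0:
  assumes "finite (S p)" "S p \<noteq> {}"
  shows "poly (trimmed S c p) 0 = c (p, Min (S p))"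
proof -
  have "poly (trimmed S c p) 0 = (\<Sum>k\<in>{Min (S p)}. c (p, k) * 0 ^ (k - Min (S p)))"
    unfolding trimmed_def poly_sum poly_monom
  proof (rule sum.mono_neutral_right[OF assms(1)])
    show "{Min (S p)} \<subseteq> S p" using assms by simp
    show "\<forall>k\<in>S p - {Min (S p)}. c (p, k) * 0 ^ (k - Min (S p)) = 0"
      using Min_le[OF assms(1)] by (fastforce simp: zero_power)
  qed
  then show ?thesis by simp
qed

text \<open>
  The projection along a compact factor is a closed map.
\<close>

lemma closedin_compact_zero_locus:
  fixes w :: "'a \<times> complex \<Rightarrow> real"
  assumes "compact K" "continuous_map (prod_topology X (top_of_set K)) euclidean w"
  shows "closedin X {c \<in> topspace X. \<exists>t\<in>K. w (c, t) = 0}"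
proof -
  let ?Y = "top_of_set K"
  have cl: "closedin (prod_topology X ?Y) {z \<in> topspace (prod_topology X ?Y). w z \<in> {0}}"
    by (rule closedin_continuous_map_preimage[OF assms(2)]) auto
  have "compact_space ?Y" using assms(1) by (simp add: compact_space_subtopology)
  then have "closedin X (fst ` {z \<in> topspace (prod_topology X ?Y). w z \<in> {0}})"
    using Abstract_Topological_Spaces.closed_map_fst cl unfolding closed_map_def by blast
  moreover have "fst ` {z \<in> topspace (prod_topology X ?Y). w z \<in> {0}} = {c \<in> topspace X. \<exists>t\<in>K. w (c, t) = 0}"
    by force
  ultimately show ?thesis by simp
qed

lemma continuous_map_mult_field:
  fixes f g :: "'a \<Rightarrow> 'b::real_normed_field"
  shows "continuous_map X euclidean f \<Longrightarrow> continuous_map X euclidean g \<Longrightarrow> continuous_map X euclidean (\<lambda>x. f x * g x)"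
  by (simp add: continuous_map_atin tendsto_mult)

lemma continuous_map_power_field:
  fixes f :: "'a \<Rightarrow> 'b::real_normed_field"
  shows "continuous_map X euclidean f \<Longrightarrow> continuous_map X euclidean (\<lambda>x. f x ^ n)"
  by (simp add: continuous_map_atin tendsto_power)

lemma continuous_map_family_eval:
  assumes "finite (S p)"
  shows "continuous_map (prod_topology (coeff_space S) (top_of_set K)) euclidean
     (\<lambda>(c, t). \<Sum>k\<in>S p. c (p, k) * t ^ e k)"
proof -
  have c: "continuous_map (prod_topology (coeff_space S) (top_of_set K)) euclidean (\<lambda>z. fst z (p, k))"
    if "k \<in> S p" for k
    using that unfolding coeff_space_def
    by (intro continuous_map_compose[OF continuous_map_fst, unfolded o_def] continuous_map_product_projection) auto
  have t: "continuous_map (prod_topology (coeff_space S) (top_of_set K)) euclidean snd"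
    by (rule continuous_map_into_fulltopology[OF continuous_map_snd])
  show ?thesis unfolding case_prod_unfold
    using assms c t by (intro continuous_map_sum continuous_map_mult_field continuous_map_power_field)
qed

lemma nonempty_open_minus_finite:
  fixes U :: "complex set"
  assumes "open U" "U \<noteq> {}" "finite E" shows "\<exists>z\<in>U. z \<notin> E"
  using assms finite_imp_not_open[of U] finite_subset[of U E] by blast

definition coprime_poles :: "(part \<Rightarrow> nat set) \<Rightarrow> (part \<times> nat \<Rightarrow> complex) \<Rightarrow> bool" where
  "coprime_poles S c \<longleftrightarrow> (\<forall>p. \<forall>k\<in>S p. c (p, k) \<noteq> 0) \<and>
     (\<forall>t. poly (trimmed S c Q0) t = 0 \<longrightarrow> poly (trimmed S c Q1) t \<noteq> 0)"

text \<open>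
  Openness is a compactness argument: common roots in the closed unit disc form a closed condition
  on the coefficients, and common roots outside it become roots in the disc after reversing the
  order of the coefficients. For density, the lowest coefficient of \<open>Q1\<close> is
  perturbed: a common root forces it to take one of finitely many values.
\<close>

lemma generically_coprime_poles:
  assumes fin: "\<And>p. finite (S p)" and ne: "S Q0 \<noteq> {}" "S Q1 \<noteq> {}"
  shows "generically S (coprime_poles S)"
proof -
  let ?X = "coeff_space S"
  let ?I = "SIGMA p:UNIV. S p"
  have "finite (UNIV :: part set)"
  proof (rule finite_subset)
    show "UNIV \<subseteq> {P0, Q0, P1, Q1}" using part.exhaust by blast
  qed simp
  then have finI: "finite ?I" using fin by (intro finite_SigmaI)
  define V where "V = {c \<in> topspace ?X. \<forall>i\<in>?I. c i \<noteq> 0}"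
  have "openin ?X {c \<in> topspace ?X. c i \<in> - {0}}" if "i \<in> ?I" for i
    unfolding coeff_space_def using that
    by (intro openin_continuous_map_preimage[OF continuous_map_product_projection]) auto
  then have "openin ?X (topspace ?X \<inter> (\<Inter>i\<in>?I. {c \<in> topspace ?X. c i \<in> - {0}}))"
    using finI by (cases "?I = {}") (auto intro!: openin_Int openin_INT2)
  moreover have "topspace ?X \<inter> (\<Inter>i\<in>?I. {c \<in> topspace ?X. c i \<in> - {0}}) = V" by (auto simp: V_def)
  ultimately have openV: "openin ?X V" by simp
  \<comment> \<open>the trimmed polynomial and its reversal, as functions of coefficients and argument\<close>
  define low :: "part \<Rightarrow> (part \<times> nat \<Rightarrow> complex) \<times> complex \<Rightarrow> complex"
    where "low p = (\<lambda>(c, t). \<Sum>k\<in>S p. c (p, k) * t ^ (k - Min (S p)))" for p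
  define high :: "part \<Rightarrow> (part \<times> nat \<Rightarrow> complex) \<times> complex \<Rightarrow> complex"
    where "high p = (\<lambda>(c, t). \<Sum>k\<in>S p. c (p, k) * t ^ (Max (S p) - k))" for p
  define E where "E = {c \<in> topspace ?X. \<exists>t\<in>cball 0 1. norm (low Q0 (c, t)) + norm (low Q1 (c, t)) = 0}"
  define E' where "E' = {c \<in> topspace ?X. \<exists>t\<in>cball 0 1. norm (high Q0 (c, t)) + norm (high Q1 (c, t)) = 0}"
  have closed: "closedin ?X E" "closedin ?X E'"
    unfolding E_def E'_def low_def high_def
    by (intro closedin_compact_zero_locus[where w = "\<lambda>z. norm (f z) + norm (h z)" for f h] compact_cball
      continuous_map_add continuous_map_norm continuous_map_family_eval fin)+
  have low: "low p (c, t) = poly (trimmed S c p) t" for p c t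
    by (simp add: low_def trimmed_def poly_sum poly_monom)
  have high: "t ^ (Max (S p) - Min (S p)) * high p (c, inverse t) = poly (trimmed S c p) t"
    if "t \<noteq> 0" for p c t
  proof -
    have *: "t ^ (Max (S p) - Min (S p)) * (c (p, k) * inverse t ^ (Max (S p) - k)) = c (p, k) * t ^ (k - Min (S p))"
      if "k \<in> S p" for k
    proof -
      have "Min (S p) \<le> k" "k \<le> Max (S p)" using that fin by auto
      then have "Max (S p) - Min (S p) = (Max (S p) - k) + (k - Min (S p))" by simp
      then show ?thesis using \<open>t \<noteq> 0\<close> by (simp add: power_add power_inverse)
    qed
    have "t ^ (Max (S p) - Min (S p)) * high p (c, inverse t) =
        (\<Sum>k\<in>S p. t ^ (Max (S p) - Min (S p)) * (c (p, k) * inverse t ^ (Max (S p) - k)))"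
      by (simp add: high_def sum_distrib_left)
    also have "\<dots> = (\<Sum>k\<in>S p. c (p, k) * t ^ (k - Min (S p)))" by (rule sum.cong[OF refl *])
    finally show ?thesis by (simp add: trimmed_def poly_sum poly_monom)
  qed
  have high0: "high p (c, 0) = c (p, Max (S p))" if "S p \<noteq> {}" for p c
  proof -
    have "high p (c, 0) = (\<Sum>k\<in>{Max (S p)}. c (p, k) * 0 ^ (Max (S p) - k))"
      unfolding high_def prod.case
    proof (rule sum.mono_neutral_right[OF fin])
      show "{Max (S p)} \<subseteq> S p" using that fin by simp
      show "\<forall>k\<in>S p - {Max (S p)}. c (p, k) * 0 ^ (Max (S p) - k) = 0"
        using fin[of p] Max_ge[OF fin[of p]] by (fastforce simp: zero_power)
    qed
    then show ?thesis by simp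
  qed
  have good: "c \<in> V - E - E' \<longleftrightarrow> c \<in> topspace ?X \<and> coprime_poles S c" for c
  proof
    assume c: "c \<in> V - E - E'"
    have "poly (trimmed S c Q1) t \<noteq> 0" if 0: "poly (trimmed S c Q0) t = 0" for t
    proof
      assume 1: "poly (trimmed S c Q1) t = 0"
      show False
      proof (cases "norm t \<le> 1")
        case True
        then have "t \<in> cball 0 1" "norm (low Q0 (c, t)) + norm (low Q1 (c, t)) = 0"
          using 0 1 by (simp_all add: low)
        then have "c \<in> E" using c unfolding E_def V_def by blast
        then show False using c by simp
      next
        case False
        then have "t \<noteq> 0" "norm (inverse t) \<le> 1" by (auto simp: norm_inverse inverse_le_1_iff)
        then have "inverse t \<in> cball 0 1"
          "norm (high Q0 (c, inverse t)) + norm (high Q1 (c, inverse t)) = 0"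
          using 0 1 high[of t Q0 c] high[of t Q1 c] by simp_all
        then have "c \<in> E'" using c unfolding E'_def V_def by blast
        then show False using c by simp
      qed
    qed
    then show "c \<in> topspace ?X \<and> coprime_poles S c" using c by (auto simp: V_def coprime_poles_def)
  next
    assume c: "c \<in> topspace ?X \<and> coprime_poles S c"
    then have "c \<in> V" by (auto simp: V_def coprime_poles_def)
    moreover have "c \<notin> E" using c by (auto simp: E_def low coprime_poles_def add_nonneg_eq_0_iff)
    moreover have "c \<notin> E'"
    proof
      assume "c \<in> E'"
      then obtain t where t: "high Q0 (c, t) = 0" "high Q1 (c, t) = 0" by (auto simp: E'_def add_nonneg_eq_0_iff)
      have "Max (S Q0) \<in> S Q0" using fin ne by simp
      then have "high Q0 (c, 0) \<noteq> 0" using c high0[OF ne(1)] by (auto simp: coprime_poles_def)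
      then have "t \<noteq> 0" using t(1) by auto
      then show False using high[of "inverse t" Q0 c] high[of "inverse t" Q1 c] t c by (auto simp: coprime_poles_def)
    qed
    ultimately show "c \<in> V - E - E'" by simp
  qed
  have "(V - E - E') \<inter> W \<noteq> {}" if W: "openin ?X W" "W \<noteq> {}" for W
  proof -
    obtain x where "x \<in> W" using W by auto
    then obtain U where U: "\<And>i. i \<in> ?I \<Longrightarrow> open (U i)" "x \<in> PiE ?I U" "PiE ?I U \<subseteq> W"
    proof -
      have "\<forall>x\<in>W. \<exists>U. finite {i \<in> ?I. U i \<noteq> topspace euclidean} \<and> (\<forall>i\<in>?I. openin euclidean (U i)) \<and>
          x \<in> PiE ?I U \<and> PiE ?I U \<subseteq> W"
        using W(1) unfolding coeff_space_def openin_product_topology_alt .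
      then show ?thesis using \<open>x \<in> W\<close> that by (metis open_openin)
    qed
    have neU: "U i \<noteq> {}" if "i \<in> ?I" for i using that U(2) by auto
    have "\<exists>z\<in>U i. z \<noteq> 0" if "i \<in> ?I" for i
      using nonempty_open_minus_finite[of "U i" "{0}"] U(1) neU that by auto
    then obtain d where d: "\<And>i. i \<in> ?I \<Longrightarrow> d i \<in> U i \<and> d i \<noteq> 0" by metis
    define i0 where "i0 = (Q1, Min (S Q1))"
    have i0: "i0 \<in> ?I" using fin ne by (simp add: i0_def)
    define h where "h t = (\<Sum>k\<in>S Q1 - {Min (S Q1)}. d (Q1, k) * t ^ (k - Min (S Q1)))" for t
    have tr0: "poly (trimmed S d Q0) 0 \<noteq> 0"
      using d[of "(Q0, Min (S Q0))"] fin ne by (simp add: poly_trimmed_0)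
    then have "trimmed S d Q0 \<noteq> 0" by auto
    then have "finite (insert 0 ((\<lambda>t. - h t) ` {t. poly (trimmed S d Q0) t = 0}))"
      by (simp add: poly_roots_finite)
    then obtain z where z: "z \<in> U i0" "z \<notin> insert 0 ((\<lambda>t. - h t) ` {t. poly (trimmed S d Q0) t = 0})"
      using nonempty_open_minus_finite[of "U i0"] U(1) neU i0 by meson
    define c where "c = (\<lambda>i\<in>?I. if i = i0 then z else d i)"
    have "c \<in> PiE ?I U" using d z by (auto simp: c_def)
    then have "c \<in> W" using U(3) by auto
    have "trimmed S c Q0 = trimmed S d Q0"
      unfolding trimmed_def by (rule sum.cong) (auto simp: c_def i0_def)
    moreover have "poly (trimmed S c Q1) t = z + h t" for t
    proof -
      have "poly (trimmed S c Q1) t = (\<Sum>k\<in>S Q1. c (Q1, k) * t ^ (k - Min (S Q1)))"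
        by (simp add: trimmed_def poly_sum poly_monom)
      also have "\<dots> = c i0 + (\<Sum>k\<in>S Q1 - {Min (S Q1)}. c (Q1, k) * t ^ (k - Min (S Q1)))"
        using fin ne by (simp add: sum.remove[of _ "Min (S Q1)"] i0_def)
      also have "c i0 = z" using i0 by (simp add: c_def)
      also have "(\<Sum>k\<in>S Q1 - {Min (S Q1)}. c (Q1, k) * t ^ (k - Min (S Q1))) = h t"
        unfolding h_def by (rule sum.cong) (auto simp: c_def i0_def)
      finally show ?thesis .
    qed
    moreover have "z + h t \<noteq> 0" if "poly (trimmed S d Q0) t = 0" for t
    proof
      assume "z + h t = 0"
      then have "z = - h t" by (simp add: eq_neg_iff_add_eq_0)
      then show False using z(2) that by blast
    qed
    moreover have "\<forall>p. \<forall>k\<in>S p. c (p, k) \<noteq> 0" using d z by (auto simp: c_def)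
    ultimately have "coprime_poles S c" by (simp add: coprime_poles_def)
    moreover have "c \<in> topspace ?X" using \<open>c \<in> W\<close> openin_subset[OF W(1)] by auto
    ultimately have "c \<in> V - E - E'" using good by blast
    then show ?thesis using \<open>c \<in> W\<close> by blast
  qed
  then have "?X closure_of (V - E - E') = topspace ?X" by (simp add: dense_intersects_open)
  moreover have "openin ?X (V - E - E')" using openV closed by (intro openin_diff)
  ultimately show ?thesis
    unfolding generically_def using good by (intro exI[of _ "V - E - E'"]) auto
qed

section \<open>Triangulations of two rows of points\<close>

lemma row_point_in_triangle:
  assumes "r \<noteq> s" "lattice_pt (k, s) \<in> convex hull {lattice_pt (a, r), lattice_pt (b, s), lattice_pt (b', s)}" "b \<le> b'"
  shows "b \<le> k" "k \<le> b'"
proof -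
  obtain w x y where w: "0 \<le> w" "0 \<le> x" "0 \<le> y" "w + x + y = 1"
    and eq: "real k = w * real a + x * real b + y * real b'" "real s = w * real r + x * real s + y * real s"
    using assms(2) by (auto simp: convex_hull_3 lattice_pt_def)
  have "w * (real s - real r) = 0" using eq(2) w(4) by algebra
  then have "w = 0" using assms(1) by simp
  then have k: "real k = x * real b + y * real b'" "x = 1 - y" using eq w by auto
  have "real b \<le> real k" "real k \<le> real b'"
    using mult_left_mono[of "real b" "real b'" y] mult_left_mono[of "real b" "real b'" x] assms(3) w
    unfolding k(1) k(2) by (auto simp: algebra_simps)
  then show "b \<le> k" "k \<le> b'" by auto
qed

lemma apex_in_triangle:
  assumes "r \<noteq> s" "lattice_pt (k, r) \<in> convex hull {lattice_pt (a, r), lattice_pt (b, s), lattice_pt (b', s)}"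
  shows "k = a"
proof -
  obtain w x y where w: "0 \<le> w" "0 \<le> x" "0 \<le> y" "w + x + y = 1"
    and eq: "real k = w * real a + x * real b + y * real b'" "real r = w * real r + x * real s + y * real s"
    using assms(2) by (auto simp: convex_hull_3 lattice_pt_def)
  have "(x + y) * (real s - real r) = 0" using eq(2) w(4) by algebra
  then have "x + y = 0" using assms(1) by simp
  then have "x = 0" "y = 0" "w = 1" using w by auto
  then show ?thesis using eq by simp
qed

text \<open>
  The intersection of two triangles is a face of each; a face that meets the interior of a segment
  of the triangle contains the segment.
\<close>

lemma triangulation_open_segment:
  assumes "triangulation \<T>" "T \<in> \<T>" "T' \<in> \<T>" "x \<in> T'" "x \<in> open_segment p q" "p \<in> T" "q \<in> T"
  shows "p \<in> T'" "q \<in> T'"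
proof -
  have f: "T \<inter> T' face_of T" using assms by (auto simp: triangulation_def)
  have "x \<in> T"
  proof -
    obtain n where "n simplex T" using assms(1,2) by (auto simp: triangulation_def)
    then have "convex T" by (rule convex_simplex)
    then show ?thesis using assms(5-7) by (meson convex_contains_open_segment subsetD)
  qed
  then have "p \<in> T \<inter> T' \<and> q \<in> T \<inter> T'"
    using face_ofD[OF f assms(5)] assms \<open>x \<in> T\<close> by auto
  then show "p \<in> T'" "q \<in> T'" by auto
qed

text \<open>
  The triangles meet in the point where the two segments cross, so their common face contains the
  end points of the first segment.
\<close>

lemma crossing_edges:
  assumes tri: "triangulation \<T>" "T \<in> \<T>" "T' \<in> \<T>"
    and "lattice_pt (a, r) \<in> T" "lattice_pt (b, s) \<in> T"
    and "lattice_pt (d, r) \<in> T'" "lattice_pt (c, s) \<in> T'"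
    and less: "d < a" "b < c" and "r \<noteq> s"
  shows "lattice_pt (a, r) \<in> T'" "lattice_pt (b, s) \<in> T'"
proof -
  \<comment> \<open>the relative height at which the two segments cross\<close>
  define \<tau> where "\<tau> = (real a - real d) / ((real a - real d) + (real c - real b))"
  have \<tau>: "0 < \<tau>" "\<tau> < 1" using less by (auto simp: \<tau>_def field_simps)
  have eq: "(1 - \<tau>) * real a + \<tau> * real b = (1 - \<tau>) * real d + \<tau> * real c"
    using less by (simp add: \<tau>_def field_simps)
  define x where "x = (1 - \<tau>) *\<^sub>R lattice_pt (a, r) + \<tau> *\<^sub>R lattice_pt (b, s)"
  have x': "x = (1 - \<tau>) *\<^sub>R lattice_pt (d, r) + \<tau> *\<^sub>R lattice_pt (c, s)"
    using eq by (simp add: x_def lattice_pt_def)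
  have "convex T'" using tri by (auto simp: triangulation_def intro: convex_simplex)
  then have "x \<in> T'" unfolding x' using \<tau> assms by (intro convexD) auto
  moreover have "x \<in> open_segment (lattice_pt (a, r)) (lattice_pt (b, s))"
    using \<tau> \<open>r \<noteq> s\<close> unfolding x_def in_segment by (auto simp: lattice_pt_def)
  ultimately show "lattice_pt (a, r) \<in> T'" "lattice_pt (b, s) \<in> T'"
    using triangulation_open_segment[OF tri] assms by blast+
qed

definition row_triangle :: "nat \<Rightarrow> nat \<Rightarrow> nat \<times> nat \<times> nat \<Rightarrow> (real \<times> real) set" where
  "row_triangle r s = (\<lambda>(a, b, b'). convex hull {lattice_pt (a, r), lattice_pt (b, s), lattice_pt (b', s)})"

lemma row_triangle_vertices:
  "lattice_pt (a, r) \<in> row_triangle r s (a, b, b')" "lattice_pt (b, s) \<in> row_triangle r s (a, b, b')"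
  "lattice_pt (b', s) \<in> row_triangle r s (a, b, b')"
  by (auto simp: row_triangle_def hull_inc)

text \<open>
  Overlapping bases coincide by the face property. Triangles on the same base with different
  apices would have crossing edges.
\<close>

lemma bases_disjoint:
  assumes tri: "triangulation \<T>" and T: "row_triangle r s (a, b, b') \<in> \<T>" and T': "row_triangle r s (c, d, d') \<in> \<T>"
    and less: "b < b'" "d < d'" and "r \<noteq> s" and ne: "{b..<b'} \<inter> {d..<d'} \<noteq> {}"
  shows "(a, b, b') = (c, d, d')"
proof -
  obtain k where k: "b \<le> k" "k < b'" "d \<le> k" "k < d'" using ne by (metis IntE all_not_in_conv atLeastLessThan_iff)
  \<comment> \<open>a point in the interior of both bases\<close>
  define x where "x = (real k + 1 / 2, real s)"
  have in_seg: "x \<in> open_segment (lattice_pt (e, s)) (lattice_pt (e', s))" if "e \<le> k" "k < e'" for e e'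
  proof -
    define \<tau> where "\<tau> = (real k + 1 / 2 - real e) / (real e' - real e)"
    have "0 < \<tau>" "\<tau> < 1" using that by (auto simp: \<tau>_def field_simps)
    moreover have "x = (1 - \<tau>) *\<^sub>R lattice_pt (e, s) + \<tau> *\<^sub>R lattice_pt (e', s)"
    proof -
      have "\<tau> * (real e' - real e) = real k + 1 / 2 - real e" using that by (simp add: \<tau>_def)
      then show ?thesis by (simp add: x_def lattice_pt_def algebra_simps)
    qed
    moreover have "e \<noteq> e'" using that by auto
    ultimately show ?thesis unfolding in_segment by (auto simp: lattice_pt_def)
  qed
  have conv: "convex (row_triangle r s z)" for z by (auto simp: row_triangle_def split: prod.splits)
  have in_T: "x \<in> row_triangle r s (e, f, f')" if "f \<le> k" "k < f'" for e f f'
  proof -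
    have "open_segment (lattice_pt (f, s)) (lattice_pt (f', s)) \<subseteq> row_triangle r s (e, f, f')"
      using conv[of "(e, f, f')"] row_triangle_vertices(2,3) by (simp add: convex_contains_open_segment)
    then show ?thesis using in_seg[OF that] by blast
  qed
  have "lattice_pt (b, s) \<in> row_triangle r s (c, d, d')" "lattice_pt (b', s) \<in> row_triangle r s (c, d, d')"
    using triangulation_open_segment[OF tri T T' in_T[OF k(3,4)] in_seg[OF k(1,2)] row_triangle_vertices(2,3)] .
  then have "d \<le> b" "b' \<le> d'"
    using row_point_in_triangle[OF \<open>r \<noteq> s\<close>, of _ c d d'] less by (simp_all add: row_triangle_def)
  moreover have "lattice_pt (d, s) \<in> row_triangle r s (a, b, b')" "lattice_pt (d', s) \<in> row_triangle r s (a, b, b')"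
    using triangulation_open_segment[OF tri T' T in_T[OF k(1,2)] in_seg[OF k(3,4)] row_triangle_vertices(2,3)] .
  then have "b \<le> d" "d' \<le> b'"
    using row_point_in_triangle[OF \<open>r \<noteq> s\<close>, of _ a b b'] less by (simp_all add: row_triangle_def)
  ultimately have bd: "b = d" "b' = d'" by simp_all
  have "\<not> a < c"
  proof
    assume "a < c"
    then have "lattice_pt (c, r) \<in> row_triangle r s (a, b, b')"
      using crossing_edges(1)[OF tri T' T row_triangle_vertices(1,2) row_triangle_vertices(1,3)] less bd \<open>r \<noteq> s\<close> by simp
    then show False using apex_in_triangle[OF \<open>r \<noteq> s\<close>, of c a b b'] \<open>a < c\<close> by (simp add: row_triangle_def)
  qed
  moreover have "\<not> c < a"
  proof
    assume "c < a"
    then have "lattice_pt (a, r) \<in> row_triangle r s (c, d, d')"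
      using crossing_edges(1)[OF tri T T' row_triangle_vertices(1,2) row_triangle_vertices(1,3)] less bd \<open>r \<noteq> s\<close> by simp
    then show False using apex_in_triangle[OF \<open>r \<noteq> s\<close>, of a c d d'] \<open>c < a\<close> by (simp add: row_triangle_def)
  qed
  ultimately show ?thesis using bd by simp
qed

definition apex_triangles where
  "apex_triangles Sel r B s \<T> = {(a, b, b') \<in> Sel \<times> B \<times> B. b < b' \<and> row_triangle r s (a, b, b') \<in> \<T>}"

lemma finite_apex_triangles: "finite Sel \<Longrightarrow> finite B \<Longrightarrow> finite (apex_triangles Sel r B s \<T>)"
  unfolding apex_triangles_def by (rule finite_subset[of _ "Sel \<times> B \<times> B"]) auto

lemma apex_sum_alt: "apex_sum Sel r B s \<T> = (\<Sum>(a, b, b')\<in>apex_triangles Sel r B s \<T>. b' - b)"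
  by (simp add: apex_sum_def apex_triangles_def row_triangle_def)

text \<open>
  With disjoint bases, a sum of base lengths is the number of unit intervals \<open>[k, k +
  1]\<close> covered by the bases.
\<close>

lemma apex_sum_eq_card:
  assumes "triangulation \<T>" "r \<noteq> s" "finite Sel" "finite B"
  shows "apex_sum Sel r B s \<T> = card (\<Union>(a, b, b')\<in>apex_triangles Sel r B s \<T>. {b..<b'})"
proof -
  have "card (\<Union>z\<in>apex_triangles Sel r B s \<T>. (\<lambda>(a, b, b'). {b..<b'}) z) =
    (\<Sum>z\<in>apex_triangles Sel r B s \<T>. card ((\<lambda>(a, b, b'). {b..<b'}) z))"
  proof (rule card_UN_disjoint)
    show "finite (apex_triangles Sel r B s \<T>)" using assms by (simp add: finite_apex_triangles)
    show "\<forall>z\<in>apex_triangles Sel r B s \<T>. finite ((\<lambda>(a, b, b'). {b..<b'}) z)" by auto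
    show "\<forall>z\<in>apex_triangles Sel r B s \<T>. \<forall>z'\<in>apex_triangles Sel r B s \<T>.
        z \<noteq> z' \<longrightarrow> (\<lambda>(a, b, b'). {b..<b'}) z \<inter> (\<lambda>(a, b, b'). {b..<b'}) z' = {}"
      using bases_disjoint[OF assms(1) _ _ _ _ assms(2)] by (fastforce simp: apex_triangles_def)
  qed
  then show ?thesis by (simp add: apex_sum_alt case_prod_unfold)
qed

lemma apex_sum_le:
  assumes "triangulation \<T>" "r \<noteq> s" "finite Sel" "finite B"
    and "\<And>a b b'. (a, b, b') \<in> apex_triangles Sel r B s \<T> \<Longrightarrow> l \<le> b \<and> b' \<le> h"
  shows "apex_sum Sel r B s \<T> \<le> h - l"
proof -
  have "apex_sum Sel r B s \<T> \<le> card {l..<h}"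
    unfolding apex_sum_eq_card[OF assms(1-4)] using assms(5) by (intro card_mono) fastforce+
  then show ?thesis by simp
qed

text \<open>
  Disjoint bases of total length \<open>Max B - Min B\<close> leave no gap.
\<close>

lemma bases_cover:
  assumes "triangulation \<T>" "r \<noteq> s" "finite Sel" "finite B"
    and full: "apex_sum Sel r B s \<T> = Max B - Min B" and k: "Min B \<le> k" "k < Max B"
  shows "\<exists>(a, b, b')\<in>apex_triangles Sel r B s \<T>. b \<le> k \<and> k < b'"
proof -
  let ?U = "\<Union>(a, b, b')\<in>apex_triangles Sel r B s \<T>. {b..<b'}"
  have "?U \<subseteq> {Min B..<Max B}"
    using assms(4) by (auto simp: apex_triangles_def intro: order.trans[OF Min_le] less_le_trans[OF _ Max_ge])
  moreover have "card ?U = card {Min B..<Max B}"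
    using full unfolding apex_sum_eq_card[OF assms(1-4)] by simp
  ultimately have "?U = {Min B..<Max B}" by (intro card_subset_eq) auto
  moreover have "k \<in> {Min B..<Max B}" using k by simp
  ultimately have "k \<in> ?U" by simp
  then show ?thesis by fastforce
qed

text \<open>
  The length of the part of row \<open>A\<close> which cannot be covered by triangles with
  selected apex in \<open>B\<close> once all of row \<open>B\<close> is covered by triangles with
  selected apex in \<open>A\<close>.
\<close>

definition uncovered where
  "uncovered A SelA B SelB = (if Min A \<notin> SelA \<and> Min B \<notin> SelB then Min SelA - Min A else 0) +
     (if Max A \<notin> SelA \<and> Max B \<notin> SelB then Max A - Max SelA else 0 :: nat)"

text \<open>
  If \<open>Min B\<close> is not selected, the unit interval at the left end of row
  \<open>s\<close> lies in the base of a triangle whose apex \<open>a\<close> is at least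
  \<open>Min SelA\<close>. A triangle with selected apex \<open>c > Min B\<close> and a base
  starting at \<open>d < a\<close> would have an edge crossing that triangle. The right end is
  symmetric.
\<close>

lemma apex_sum_le_of_full:
  assumes tri: "triangulation \<T>" and "r \<noteq> s"
    and fin: "finite A" "finite B" and sub: "SelA \<subseteq> A" "SelB \<subseteq> B" "SelA \<noteq> {}" "SelB \<noteq> {}"
    and full: "apex_sum SelA r B s \<T> = Max B - Min B"
  shows "apex_sum SelB s A r \<T> \<le> Max A - Min A - uncovered A SelA B SelB"
proof -
  have finS: "finite SelA" "finite SelB" using fin sub finite_subset by auto
  define l where "l = (if Min A \<notin> SelA \<and> Min B \<notin> SelB then Min SelA else Min A)"
  define h where "h = (if Max A \<notin> SelA \<and> Max B \<notin> SelB then Max SelA else Max A)"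
  have "l \<le> d \<and> d' \<le> h" if t: "(c, d, d') \<in> apex_triangles SelB s A r \<T>" for c d d'
  proof -
    have c: "c \<in> SelB" "d \<in> A" "d' \<in> A" "d < d'" "row_triangle s r (c, d, d') \<in> \<T>"
      using t by (auto simp: apex_triangles_def)
    have cB: "Min B \<le> c" "c \<le> Max B" using c sub fin by auto
    have "Min SelA \<le> d" if ns: "Min B \<notin> SelB"
    proof -
      have "Min B < c" using cB ns c(1) by (metis order_le_less)
      then obtain a b b' where abb: "(a, b, b') \<in> apex_triangles SelA r B s \<T>" "b \<le> Min B"
        using bases_cover[OF tri \<open>r \<noteq> s\<close> finS(1) fin(2) full, of "Min B"] cB by fastforce
      then have abb': "a \<in> SelA" "b \<in> B" "b < b'" "row_triangle r s (a, b, b') \<in> \<T>"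
        by (auto simp: apex_triangles_def)
      have "a \<le> d"
      proof (rule ccontr)
        assume "\<not> a \<le> d"
        then have "lattice_pt (b, s) \<in> row_triangle s r (c, d, d')"
          using \<open>Min B < c\<close> abb(2)
          by (intro crossing_edges(2)[OF tri abb'(4) c(5), of a r b s d c])
            (auto simp: row_triangle_vertices \<open>r \<noteq> s\<close>)
        then have "b = c" using apex_in_triangle[of s r b c d d'] \<open>r \<noteq> s\<close> by (simp add: row_triangle_def)
        then show False using \<open>Min B < c\<close> abb(2) by simp
      qed
      then show ?thesis using abb' finS by (meson Min_le order_trans)
    qed
    moreover have "d' \<le> Max SelA" if ns: "Max B \<notin> SelB"
    proof -
      have "c < Max B" using cB ns c(1) by (metis order_le_less)
      then obtain a b b' where abb: "(a, b, b') \<in> apex_triangles SelA r B s \<T>" "Max B \<le> b'"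
        using bases_cover[OF tri \<open>r \<noteq> s\<close> finS(1) fin(2) full, of "Max B - 1"] cB by fastforce
      then have abb': "a \<in> SelA" "b \<in> B" "b < b'" "row_triangle r s (a, b, b') \<in> \<T>"
        by (auto simp: apex_triangles_def)
      have "d' \<le> a"
      proof (rule ccontr)
        assume "\<not> d' \<le> a"
        then have "lattice_pt (d', r) \<in> row_triangle r s (a, b, b')"
          using \<open>c < Max B\<close> abb(2) \<open>\<not> d' \<le> a\<close>
          by (intro crossing_edges(1)[OF tri c(5) abb'(4), of d' r c s a b'])
            (auto simp: row_triangle_vertices \<open>r \<noteq> s\<close>)
        then have "d' = a" using apex_in_triangle[of r s d' a b b'] \<open>r \<noteq> s\<close> by (simp add: row_triangle_def)
        then show False using \<open>\<not> d' \<le> a\<close> by simp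
      qed
      then show ?thesis using abb' finS by (meson Max_ge order_trans)
    qed
    ultimately show ?thesis using c fin by (auto simp: l_def h_def)
  qed
  then have "apex_sum SelB s A r \<T> \<le> h - l"
    using tri \<open>r \<noteq> s\<close> finS fin by (intro apex_sum_le) auto
  also have "h - l = Max A - Min A - uncovered A SelA B SelB"
  proof -
    have "Min SelA \<in> A" "Max SelA \<in> A" using sub finS Min_in Max_in by blast+
    then have "Min A \<le> Min SelA" "Max SelA \<le> Max A" using fin by auto
    then show ?thesis by (auto simp: h_def l_def uncovered_def)
  qed
  finally show ?thesis .
qed

definition trapezoid :: "nat \<Rightarrow> nat \<Rightarrow> nat \<Rightarrow> nat \<Rightarrow> (real \<times> real) set" where
  "trapezoid p q p' q' = {(x, y). 0 \<le> y \<and> y \<le> 1 \<and> (1 - y) * real p + y * real q \<le> x \<and>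
     x \<le> (1 - y) * real p' + y * real q'}"

lemma convex_trapezoid: "convex (trapezoid p q p' q')"
proof -
  have eq: "trapezoid p q p' q' = {z. (0, -1) \<bullet> z \<le> (0::real)} \<inter> {z. (0, 1) \<bullet> z \<le> 1} \<inter>
      {z. (-1, real q - real p) \<bullet> z \<le> - real p} \<inter> {z. (1, real p' - real q') \<bullet> z \<le> real p'}"
    by (auto simp: trapezoid_def inner_prod_def algebra_simps)
  show ?thesis unfolding eq by (intro convex_Int convex_halfspace_le)
qed

lemma trapezoid_eq_hull:
  assumes "p \<le> p'" "q \<le> q'"
  shows "trapezoid p q p' q' = convex hull {lattice_pt (p, 0), lattice_pt (q, 1), lattice_pt (p', 0), lattice_pt (q', 1)}"
    (is "_ = convex hull ?V")
proof
  show "convex hull ?V \<subseteq> trapezoid p q p' q'"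
    using assms by (intro hull_minimal convex_trapezoid) (auto simp: trapezoid_def lattice_pt_def)
  show "trapezoid p q p' q' \<subseteq> convex hull ?V"
  proof
    fix z assume "z \<in> trapezoid p q p' q'"
    then obtain x y where z: "z = (x, y)" and y: "0 \<le> y" "y \<le> 1"
      and x: "(1 - y) * real p + y * real q \<le> x" "x \<le> (1 - y) * real p' + y * real q'"
      by (auto simp: trapezoid_def)
    have V: "v \<in> convex hull ?V" if "v \<in> ?V" for v using that by (rule hull_inc)
    have "(1 - y) *\<^sub>R lattice_pt (p, 0) + y *\<^sub>R lattice_pt (q, 1) \<in> convex hull ?V"
      using y by (intro convexD[OF convex_convex_hull] V) auto
    then have l: "((1 - y) * real p + y * real q, y) \<in> convex hull ?V" by (simp add: lattice_pt_def)
    have "(1 - y) *\<^sub>R lattice_pt (p', 0) + y *\<^sub>R lattice_pt (q', 1) \<in> convex hull ?V"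
      using y by (intro convexD[OF convex_convex_hull] V) auto
    then have r: "((1 - y) * real p' + y * real q', y) \<in> convex hull ?V" by (simp add: lattice_pt_def)
    have "x \<in> closed_segment ((1 - y) * real p + y * real q) ((1 - y) * real p' + y * real q')"
      using x by (simp add: closed_segment_eq_real_ivl)
    then obtain \<tau> where \<tau>: "0 \<le> \<tau>" "\<tau> \<le> 1"
      "x = (1 - \<tau>) * ((1 - y) * real p + y * real q) + \<tau> * ((1 - y) * real p' + y * real q')"
      unfolding in_segment by auto
    have "z = (1 - \<tau>) *\<^sub>R ((1 - y) * real p + y * real q, y) + \<tau> *\<^sub>R ((1 - y) * real p' + y * real q', y)"
      by (simp add: z \<tau>(3) algebra_simps)
    also have "\<dots> \<in> convex hull ?V" using \<tau> by (intro convexD[OF convex_convex_hull] l r) auto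
    finally show "z \<in> convex hull ?V" .
  qed
qed

lemma hull_config:
  assumes "finite A" "finite B" "A \<noteq> {}" "B \<noteq> {}"
  shows "convex hull (config A B) = trapezoid (Min A) (Min B) (Max A) (Max B)"
proof
  show "convex hull (config A B) \<subseteq> trapezoid (Min A) (Min B) (Max A) (Max B)"
    using assms by (intro hull_minimal convex_trapezoid) (auto simp: config_def trapezoid_def lattice_pt_def)
  have "Min A \<le> Max A" "Min B \<le> Max B" using assms by (simp_all add: Max_ge_iff Min_le_iff) 
  then show "trapezoid (Min A) (Min B) (Max A) (Max B) \<subseteq> convex hull (config A B)"
  proof (subst trapezoid_eq_hull)
    have "Min A \<in> A" "Max A \<in> A" "Min B \<in> B" "Max B \<in> B" using assms by auto
    then show "convex hull {lattice_pt (Min A, 0), lattice_pt (Min B, 1), lattice_pt (Max A, 0), lattice_pt (Max B, 1)}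
        \<subseteq> convex hull config A B"
      by (intro hull_mono) (auto simp: config_def)
  qed
qed

text \<open>
  A triangulation built from left to right up to the segment from \<open>(p, 0)\<close> to
  \<open>(q, 1)\<close>. The empty triangulation is the start, where the trapezoid degenerates to
  a segment that no set of triangles covers.
\<close>

definition strip_triangulation where
  "strip_triangulation A B \<T> p q \<longleftrightarrow>
     triangulation \<T> \<and> (\<forall>T\<in>\<T>. 2 simplex T \<and> {v. v extreme_point_of T} \<subseteq> config A B) \<and>
     p \<in> A \<and> q \<in> B \<and> Min A \<le> p \<and> Min B \<le> q \<and>
     (\<T> = {} \<and> p = Min A \<and> q = Min B \<or> \<Union>\<T> = trapezoid (Min A) (Min B) p q)"

text \<open>
  The new triangle and the old ones lie on different sides of the line through \<open>(p,
  0)\<close> and \<open>(q, 1)\<close>. Hence an old triangle meets the new one in its face on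
  this line, which by the Krein-Milman theorem is spanned by some of these two points.
\<close>

lemma strip_triangulation_step:
  assumes st: "strip_triangulation A B \<T> p q"
    and new: "p' = p \<and> q < q' \<and> q' \<in> B \<and> w = lattice_pt (q', 1) \<or> q' = q \<and> p < p' \<and> p' \<in> A \<and> w = lattice_pt (p', 0)"
  defines "T \<equiv> convex hull {w, lattice_pt (p, 0), lattice_pt (q, 1)}"
  shows "strip_triangulation A B (insert T \<T>) p' q'"
proof -
  let ?P = "lattice_pt (p, 0)" and ?Q = "lattice_pt (q, 1)"
  have pq: "p \<in> A" "q \<in> B" "Min A \<le> p" "Min B \<le> q" and tri: "triangulation \<T>"
    and simp2: "\<And>T. T \<in> \<T> \<Longrightarrow> 2 simplex T" and ext: "\<And>T. T \<in> \<T> \<Longrightarrow> {v. v extreme_point_of T} \<subseteq> config A B"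
    and un: "\<T> = {} \<and> p = Min A \<and> q = Min B \<or> \<Union>\<T> = trapezoid (Min A) (Min B) p q"
    using st by (auto simp: strip_triangulation_def)
  have le: "p \<le> p'" "q \<le> q'" using new by auto
  have Tq: "T = trapezoid p q p' q'"
  proof -
    have "{w, ?P, ?Q} = {?P, ?Q, lattice_pt (p', 0), lattice_pt (q', 1)}" using new by auto
    then show ?thesis unfolding T_def trapezoid_eq_hull[OF le] by simp
  qed
  have indep: "\<not> affine_dependent {w, ?P, ?Q}"
  proof (rule affine_independent_insert)
    show "\<not> affine_dependent {?P, ?Q}" by (rule affine_independent_2)
    show "w \<notin> affine hull {?P, ?Q}"
    proof
      assume "w \<in> affine hull {?P, ?Q}"
      then obtain u v where "u + v = 1" "w = u *\<^sub>R ?P + v *\<^sub>R ?Q" by (auto simp: affine_hull_2)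
      then show False using new by (auto simp: lattice_pt_def)
    qed
  qed
  have distinct: "w \<noteq> ?P" "w \<noteq> ?Q" "?P \<noteq> ?Q" using new by (auto simp: lattice_pt_def)
  have T2: "2 simplex T" unfolding simplex_def T_def
    by (intro exI[of _ "{w, ?P, ?Q}"] conjI indep refl) (use distinct in simp)
  have Text: "{v. v extreme_point_of T} \<subseteq> config A B"
  proof -
    have "{v. v extreme_point_of T} \<subseteq> {w, ?P, ?Q}"
      unfolding T_def using extreme_point_of_convex_hull by auto
    also have "\<dots> \<subseteq> config A B" using new pq by (auto simp: config_def)
    finally show ?thesis .
  qed
  have faces: "T \<inter> T' face_of T \<and> T \<inter> T' face_of T'" if T': "T' \<in> \<T>" for T'
  proof -
    \<comment> \<open>a normal of the line through \<open>(p, 0)\<close> and \<open>(q, 1)\<close>\<close>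
    let ?a = "(1, real p - real q)"
    have sub: "T' \<subseteq> trapezoid (Min A) (Min B) p q" using un T' by auto
    define F where "F = T' \<inter> {z. ?a \<bullet> z = real p}"
    have cT': "convex T'" "compact T'" using simp2[OF T'] by (auto intro: convex_simplex compact_simplex)
    have F_face: "F face_of T'"
      unfolding F_def
      by (rule face_of_Int_supporting_hyperplane_le[OF cT'(1)])
        (use sub in \<open>auto simp: trapezoid_def inner_prod_def algebra_simps\<close>)
    have "T \<inter> T' = F"
    proof
      show "T \<inter> T' \<subseteq> F" using sub unfolding Tq F_def by (auto simp: trapezoid_def inner_prod_def algebra_simps)
      show "F \<subseteq> T \<inter> T'"
      proof
        fix z assume z: "z \<in> F"
        then obtain x y where xy: "z = (x, y)" "0 \<le> y" "y \<le> 1" "x + (real p - real q) * y = real p"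
          using sub by (auto simp: F_def trapezoid_def inner_prod_def)
        have "x = (1 - y) * real p + y * real q" using xy(4) by (simp add: algebra_simps)
        moreover have "(1 - y) * real p \<le> (1 - y) * real p'" "y * real q \<le> y * real q'"
          using xy le by (auto intro!: mult_left_mono)
        ultimately have "z \<in> T" unfolding Tq trapezoid_def using xy by auto
        then show "z \<in> T \<inter> T'" using z by (auto simp: F_def)
      qed
    qed
    moreover have "F face_of T"
    proof -
      have "{v. v extreme_point_of F} \<subseteq> {?P, ?Q}"
      proof
        fix v assume "v \<in> {v. v extreme_point_of F}"
        then have v: "v extreme_point_of F" by simp
        then have "v extreme_point_of T'" using extreme_point_of_face[OF F_face] by auto
        then have "v \<in> config A B" using ext[OF T'] by auto
        moreover have "fst v + (real p - real q) * snd v = real p"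
          using v by (auto simp: extreme_point_of_def F_def inner_prod_def)
        ultimately show "v \<in> {?P, ?Q}" by (auto simp: config_def lattice_pt_def)
      qed
      moreover have "F = convex hull {v. v extreme_point_of F}"
        using F_face cT' by (intro Krein_Milman_Minkowski) (auto intro: face_of_imp_compact face_of_imp_convex)
      ultimately show ?thesis unfolding T_def face_of_convex_hull_affine_independent[OF indep] by blast
    qed
    ultimately show ?thesis using F_face by simp
  qed
  have "convex T" by (simp add: T_def)
  then have "triangulation (insert T \<T>)"
    using tri T2 faces unfolding triangulation_def
    by (auto simp: face_of_refl Int_commute)
  moreover have "\<Union>(insert T \<T>) = trapezoid (Min A) (Min B) p' q'"
  proof -
    have mono: "(1 - y) * real p \<le> (1 - y) * real p'" "y * real q \<le> y * real q'"
      "(1 - y) * real (Min A) \<le> (1 - y) * real p" "y * real (Min B) \<le> y * real q" if "0 \<le> y" "y \<le> 1" for y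
      using that le pq by (auto intro!: mult_left_mono)
    have "T \<union> trapezoid (Min A) (Min B) p q = trapezoid (Min A) (Min B) p' q'"
      unfolding Tq
    proof (intro set_eqI)
      fix z :: "real \<times> real"
      obtain x y where "z = (x, y)" by (cases z)
      then show "z \<in> trapezoid p q p' q' \<union> trapezoid (Min A) (Min B) p q \<longleftrightarrow> z \<in> trapezoid (Min A) (Min B) p' q'"
        using mono[of y] by (auto simp: trapezoid_def)
    qed
    then show ?thesis using un Tq by auto
  qed
  ultimately show ?thesis
    using simp2 ext T2 Text pq le new unfolding strip_triangulation_def by auto
qed

lemma strip_triangulation_step_row0:
  assumes "strip_triangulation A B \<T> p q" "p' \<in> A" "p \<le> p'"
  shows "\<exists>\<T>'. \<T> \<subseteq> \<T>' \<and> strip_triangulation A B \<T>' p' q \<and> (p < p' \<longrightarrow> row_triangle 1 0 (q, p, p') \<in> \<T>')"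
proof (cases "p < p'")
  case True
  have "{lattice_pt (p', 0), lattice_pt (p, 0), lattice_pt (q, 1)} = {lattice_pt (q, 1), lattice_pt (p, 0), lattice_pt (p', 0)}"
    by auto
  then show ?thesis
    using strip_triangulation_step[OF assms(1), of p' q "lattice_pt (p', 0)"] True assms
    by (intro exI[of _ "insert (row_triangle 1 0 (q, p, p')) \<T>"]) (auto simp: row_triangle_def)
qed (use assms in auto)

lemma strip_triangulation_step_row1:
  assumes "strip_triangulation A B \<T> p q" "q' \<in> B" "q \<le> q'"
  shows "\<exists>\<T>'. \<T> \<subseteq> \<T>' \<and> strip_triangulation A B \<T>' p q' \<and> (q < q' \<longrightarrow> row_triangle 0 1 (p, q, q') \<in> \<T>')"
proof (cases "q < q'")
  case True
  have "{lattice_pt (q', 1), lattice_pt (p, 0), lattice_pt (q, 1)} = {lattice_pt (p, 0), lattice_pt (q, 1), lattice_pt (q', 1)}"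
    by auto
  then show ?thesis
    using strip_triangulation_step[OF assms(1), of p q' "lattice_pt (q', 1)"] True assms
    by (intro exI[of _ "insert (row_triangle 0 1 (p, q, q')) \<T>"]) (auto simp: row_triangle_def)
qed (use assms in auto)

definition row_config where
  "row_config r A B = (if r = 0 then config A B else config B A)" for r :: nat

text \<open>
  The same construction with \<open>A\<close> placed on row \<open>r\<close>, so that both orders
  of the two rows can be treated at once.
\<close>

definition row_strip where
  "row_strip r A B \<T> x y = (if r = 0 then strip_triangulation A B \<T> x y else strip_triangulation B A \<T> y x)" for r :: nat

lemma row_strip_step:
  assumes rs: "r = 0 \<and> s = 1 \<or> r = 1 \<and> s = 0" and st: "row_strip r A B \<T> x y"
  shows "x' \<in> A \<Longrightarrow> x \<le> x' \<Longrightarrow> \<exists>\<T>'. \<T> \<subseteq> \<T>' \<and> row_strip r A B \<T>' x' y \<and> (x < x' \<longrightarrow> row_triangle s r (y, x, x') \<in> \<T>')"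
    and "y' \<in> B \<Longrightarrow> y \<le> y' \<Longrightarrow> \<exists>\<T>'. \<T> \<subseteq> \<T>' \<and> row_strip r A B \<T>' x y' \<and> (y < y' \<longrightarrow> row_triangle r s (x, y, y') \<in> \<T>')"
proof -
  consider "r = 0" "s = 1" "strip_triangulation A B \<T> x y" | "r = 1" "s = 0" "strip_triangulation B A \<T> y x"
    using rs st unfolding row_strip_def by (metis zero_neq_one)
  then show "x' \<in> A \<Longrightarrow> x \<le> x' \<Longrightarrow> \<exists>\<T>'. \<T> \<subseteq> \<T>' \<and> row_strip r A B \<T>' x' y \<and> (x < x' \<longrightarrow> row_triangle s r (y, x, x') \<in> \<T>')"
    and "y' \<in> B \<Longrightarrow> y \<le> y' \<Longrightarrow> \<exists>\<T>'. \<T> \<subseteq> \<T>' \<and> row_strip r A B \<T>' x y' \<and> (y < y' \<longrightarrow> row_triangle r s (x, y, y') \<in> \<T>')"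
    using strip_triangulation_step_row0 strip_triangulation_step_row1
    unfolding row_strip_def by (cases; simp)+
qed

lemma apex_sum_ge:
  assumes "triangulation \<T>" "r \<noteq> s" "finite Sel" "finite B"
    and "\<And>k. l \<le> k \<Longrightarrow> k < h \<Longrightarrow> \<exists>(a, b, b')\<in>apex_triangles Sel r B s \<T>. b \<le> k \<and> k < b'"
  shows "h - l \<le> apex_sum Sel r B s \<T>"
proof -
  have "finite (\<Union>(a, b, b')\<in>apex_triangles Sel r B s \<T>. {b..<b'})"
    using finite_apex_triangles[OF assms(3,4)] by auto
  moreover have "{l..<h} \<subseteq> (\<Union>(a, b, b')\<in>apex_triangles Sel r B s \<T>. {b..<b'})"
    using assms(5) by fastforce
  ultimately have "card {l..<h} \<le> apex_sum Sel r B s \<T>"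
    unfolding apex_sum_eq_card[OF assms(1-4)] by (rule card_mono)
  then show ?thesis by simp
qed

text \<open>
  Going from left to right, the triangulation uses the bases \<open>[Min A, L]\<close> in row
  \<open>r\<close>, \<open>[Min B, q]\<close> in row \<open>s\<close>, \<open>[L, R]\<close>,
  \<open>[q, Max B]\<close> and \<open>[R, Max A]\<close>, where \<open>L\<close> and
  \<open>R\<close> are the extreme selected points of \<open>A\<close> and \<open>q\<close> is any
  selected point of \<open>B\<close>. The bases in row \<open>s\<close> thus have the selected
  apices \<open>L\<close> and \<open>R\<close>. Degenerate triangles are left out.
\<close>

lemma exists_optimal_triangulation:
  assumes rs: "r = 0 \<and> s = 1 \<or> r = 1 \<and> s = 0"
    and fin: "finite A" "finite B" and sub: "SelA \<subseteq> A" "SelB \<subseteq> B" "SelA \<noteq> {}" "SelB \<noteq> {}"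
    and nontriv: "Min A < Max A \<or> Min B < Max B"
  shows "\<exists>\<T>\<in>triangulations_of (row_config r A B). apex_sum SelA r B s \<T> = Max B - Min B \<and>
     apex_sum SelB s A r \<T> = Max A - Min A - uncovered A SelA B SelB"
proof -
  have finS: "finite SelA" "finite SelB" using fin sub finite_subset by auto
  have ne: "A \<noteq> {}" "B \<noteq> {}" using sub by auto
  define L where "L = Min SelA" define R where "R = Max SelA"
  obtain q where q: "q \<in> SelB" using sub by auto
  have LR: "L \<in> SelA" "R \<in> SelA" "L \<le> R" using finS sub by (auto simp: L_def R_def)
  then have LRA: "L \<in> A" "R \<in> A" "q \<in> B" using sub q by auto
  have minmax: "Min A \<in> A" "Max A \<in> A" "Min B \<in> B" "Max B \<in> B" "Min A \<le> L" "R \<le> Max A" "Min B \<le> q" "q \<le> Max B"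
    using fin ne LRA by auto
  have start: "row_strip r A B {} (Min A) (Min B)"
    using minmax by (auto simp: row_strip_def strip_triangulation_def triangulation_def)
  obtain T1 where T1: "row_strip r A B T1 L (Min B)" "Min A < L \<longrightarrow> row_triangle s r (Min B, Min A, L) \<in> T1"
    using row_strip_step(1)[OF rs start LRA(1) minmax(5)] by blast
  obtain T2 where T2: "T1 \<subseteq> T2" "row_strip r A B T2 L q" "Min B < q \<longrightarrow> row_triangle r s (L, Min B, q) \<in> T2"
    using row_strip_step(2)[OF rs T1(1) LRA(3) minmax(7)] by blast
  obtain T3 where T3: "T2 \<subseteq> T3" "row_strip r A B T3 R q" "L < R \<longrightarrow> row_triangle s r (q, L, R) \<in> T3"
    using row_strip_step(1)[OF rs T2(2) LRA(2) LR(3)] by blast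
  obtain T4 where T4: "T3 \<subseteq> T4" "row_strip r A B T4 R (Max B)" "q < Max B \<longrightarrow> row_triangle r s (R, q, Max B) \<in> T4"
    using row_strip_step(2)[OF rs T3(2) minmax(4) minmax(8)] by blast
  obtain \<T> where T5: "T4 \<subseteq> \<T>" "row_strip r A B \<T> (Max A) (Max B)" "R < Max A \<longrightarrow> row_triangle s r (Max B, R, Max A) \<in> \<T>"
    using row_strip_step(1)[OF rs T4(2) minmax(2) minmax(6)] by blast
  have \<T>: "\<T> \<in> triangulations_of (row_config r A B)"
  proof (cases "r = 0")
    case True
    then have "strip_triangulation A B \<T> (Max A) (Max B)" using T5(2) by (simp add: row_strip_def)
    then show ?thesis
      using nontriv True unfolding triangulations_of_def row_config_def strip_triangulation_def
      by (auto simp: hull_config[OF fin ne])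
  next
    case False
    then have "strip_triangulation B A \<T> (Max B) (Max A)" using T5(2) by (simp add: row_strip_def)
    then show ?thesis
      using nontriv False unfolding triangulations_of_def row_config_def strip_triangulation_def
      by (auto simp: hull_config[OF fin(2,1) ne(2,1)])
  qed
  then have tri: "triangulation \<T>" by (simp add: triangulations_of_def)
  have "r \<noteq> s" using rs by auto
  have "Max B - Min B \<le> apex_sum SelA r B s \<T>"
  proof (rule apex_sum_ge[OF tri \<open>r \<noteq> s\<close> finS(1) fin(2)])
    fix k assume k: "Min B \<le> k" "k < Max B"
    show "\<exists>(a, b, b')\<in>apex_triangles SelA r B s \<T>. b \<le> k \<and> k < b'"
    proof (cases "k < q")
      case True
      then have "(L, Min B, q) \<in> apex_triangles SelA r B s \<T>"
        using k T2 T3 T4 T5 LR LRA minmax by (auto simp: apex_triangles_def)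
      then show ?thesis using True k by blast
    next
      case False
      then have "(R, q, Max B) \<in> apex_triangles SelA r B s \<T>"
        using k T4 T5 LR LRA minmax by (auto simp: apex_triangles_def)
      then show ?thesis using False k by (intro bexI) auto
    qed
  qed
  moreover have "apex_sum SelA r B s \<T> \<le> Max B - Min B"
    using fin by (intro apex_sum_le[OF tri \<open>r \<noteq> s\<close> finS(1) fin(2)]) (auto simp: apex_triangles_def)
  ultimately have full: "apex_sum SelA r B s \<T> = Max B - Min B" by simp
  define l where "l = (if Min B \<notin> SelB then L else Min A)"
  define h where "h = (if Max B \<notin> SelB then R else Max A)"
  have "h - l \<le> apex_sum SelB s A r \<T>"
  proof (rule apex_sum_ge[OF tri \<open>r \<noteq> s\<close>[symmetric] finS(2) fin(1)])
    fix k assume k: "l \<le> k" "k < h"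
    consider "k < L" | "L \<le> k" "k < R" | "R \<le> k" by linarith
    then show "\<exists>(c, d, d')\<in>apex_triangles SelB s A r \<T>. d \<le> k \<and> k < d'"
    proof cases
      case 1
      then have "Min B \<in> SelB" "Min A \<le> k" using k by (auto simp: l_def split: if_splits)
      then have "(Min B, Min A, L) \<in> apex_triangles SelB s A r \<T>"
        using 1 T1 T2 T3 T4 T5 LRA minmax by (auto simp: apex_triangles_def)
      then show ?thesis using 1 \<open>Min A \<le> k\<close> by (intro bexI) auto
    next
      case 2
      then have "(q, L, R) \<in> apex_triangles SelB s A r \<T>"
        using q T3 T4 T5 LRA minmax by (auto simp: apex_triangles_def)
      then show ?thesis using 2 by (intro bexI) auto
    next
      case 3
      then have "Max B \<in> SelB" "k < Max A" using k by (auto simp: h_def split: if_splits)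
      then have "(Max B, R, Max A) \<in> apex_triangles SelB s A r \<T>"
        using 3 T5 LRA minmax by (auto simp: apex_triangles_def)
      then show ?thesis using 3 \<open>k < Max A\<close> by (intro bexI) auto
    qed
  qed
  moreover have "h - l = Max A - Min A - uncovered A SelA B SelB"
  proof -
    have "Min A \<in> SelA \<Longrightarrow> L = Min A" "Max A \<in> SelA \<Longrightarrow> R = Max A"
      using minmax finS by (auto simp: L_def R_def intro!: antisym)
    then show ?thesis using minmax LR by (auto simp: h_def l_def uncovered_def L_def[symmetric] R_def[symmetric])
  qed
  moreover have "apex_sum SelB s A r \<T> \<le> Max A - Min A - uncovered A SelA B SelB"
    by (rule apex_sum_le_of_full[OF tri \<open>r \<noteq> s\<close> fin sub full])
  ultimately show ?thesis using \<T> full by (intro bexI[of _ \<T>]) auto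
qed

lemma cond_max_eqI:
  assumes "\<And>T. T \<in> D \<Longrightarrow> g T \<le> G" "\<And>T. T \<in> D \<Longrightarrow> g T = G \<Longrightarrow> f T \<le> H"
    and "Topt \<in> D" "g Topt = G" "f Topt = H"
  shows "cond_max f g D = H"
proof -
  have "Max (g ` D) = G"
    using assms by (intro Max_eqI) (auto intro: finite_subset[of _ "{..G}"])
  moreover have "Max (f ` {T \<in> D. g T = G}) = H"
    using assms by (intro Max_eqI) (auto intro: finite_subset[of _ "{..H}"])
  ultimately show ?thesis by (simp add: cond_max_def)
qed

text \<open>
  The sum maximized first always reaches the whole length of row \<open>B\<close>, because one
  selected point of \<open>A\<close> can serve as apex over all of it.
\<close>

theorem cond_max_apex_sum:
  assumes rs: "r = 0 \<and> s = 1 \<or> r = 1 \<and> s = 0"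
    and fin: "finite A" "finite B" and sub: "SelA \<subseteq> A" "SelB \<subseteq> B" "SelA \<noteq> {}" "SelB \<noteq> {}"
    and nontriv: "Min A < Max A \<or> Min B < Max B"
  shows "cond_max (apex_sum SelB s A r) (apex_sum SelA r B s) (triangulations_of (row_config r A B)) =
     Max A - Min A - uncovered A SelA B SelB"
proof -
  obtain \<T> where \<T>: "\<T> \<in> triangulations_of (row_config r A B)"
    "apex_sum SelA r B s \<T> = Max B - Min B" "apex_sum SelB s A r \<T> = Max A - Min A - uncovered A SelA B SelB"
    using exists_optimal_triangulation[OF assms] by blast
  have "r \<noteq> s" using rs by auto
  have finS: "finite SelA" "finite SelB" using fin sub finite_subset by auto
  show ?thesis
  proof (rule cond_max_eqI[where Topt = \<T> and G = "Max B - Min B"])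
    fix T assume "T \<in> triangulations_of (row_config r A B)"
    then have tri: "triangulation T" by (simp add: triangulations_of_def)
    show "apex_sum SelA r B s T \<le> Max B - Min B"
      using fin by (intro apex_sum_le[OF tri \<open>r \<noteq> s\<close> finS(1) fin(2)]) (auto simp: apex_triangles_def)
    show "apex_sum SelB s A r T \<le> Max A - Min A - uncovered A SelA B SelB" if "apex_sum SelA r B s T = Max B - Min B"
      by (rule apex_sum_le_of_full[OF tri \<open>r \<noteq> s\<close> fin sub that])
  qed (use \<T> in auto)
qed

section \<open>Corners of lattice polygons\<close>

lemma on_line_in_segment:
  fixes a b z :: "real \<times> real"
  assumes "f * fst a + g * snd a = c" "f * fst b + g * snd b = c" "f * fst z + g * snd z = c"
    and "g \<noteq> 0" "fst b < fst a" "fst b \<le> fst z" "fst z \<le> fst a"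
  shows "z \<in> closed_segment a b"
proof -
  define t where "t = (fst a - fst z) / (fst a - fst b)"
  have t: "0 \<le> t" "t \<le> 1" using assms by (auto simp: t_def field_simps)
  have "t * (fst a - fst b) = fst a - fst z" using assms(5) by (simp add: t_def)
  then have x: "fst z = (1 - t) * fst a + t * fst b" by (simp add: algebra_simps)
  have "g * snd z = c - f * ((1 - t) * fst a + t * fst b)" using assms(3) x by simp
  also have "\<dots> = (1 - t) * (c - f * fst a) + t * (c - f * fst b)" by (simp add: algebra_simps)
  also have "c - f * fst a = g * snd a" using assms(1) by linarith
  also have "c - f * fst b = g * snd b" using assms(2) by linarith
  also have "(1 - t) * (g * snd a) + t * (g * snd b) = g * ((1 - t) * snd a + t * snd b)"
    by (simp add: algebra_simps)
  finally have "snd z = (1 - t) * snd a + t * snd b" using assms(4) by simp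
  then have "z = (1 - t) *\<^sub>R a + t *\<^sub>R b" using x by (simp add: prod_eq_iff)
  then show ?thesis using t unfolding in_segment by blast
qed

lemma closed_segment_edge_of:
  fixes N :: "(real \<times> real) set"
  assumes N: "convex N" and ab: "a \<in> N" "b \<in> N"
    and max: "\<And>z. z \<in> N \<Longrightarrow> f * fst z + g * snd z \<le> c"
    and line: "f * fst a + g * snd a = c" "f * fst b + g * snd b = c"
    and "g \<noteq> 0" "fst b < fst a"
    and between: "\<And>z. z \<in> N \<Longrightarrow> f * fst z + g * snd z = c \<Longrightarrow> fst b \<le> fst z \<and> fst z \<le> fst a"
  shows "closed_segment a b edge_of N"
proof -
  have "N \<inter> {z. (f, g) \<bullet> z = c} face_of N"
    using max by (intro face_of_Int_supporting_hyperplane_le N) (auto simp: inner_prod_def)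
  moreover have "N \<inter> {z. (f, g) \<bullet> z = c} = closed_segment a b"
  proof
    show "N \<inter> {z. (f, g) \<bullet> z = c} \<subseteq> closed_segment a b"
    proof
      fix z assume "z \<in> N \<inter> {z. (f, g) \<bullet> z = c}"
      then show "z \<in> closed_segment a b"
        using on_line_in_segment[OF line _ \<open>g \<noteq> 0\<close> \<open>fst b < fst a\<close>] between by (auto simp: inner_prod_def)
    qed
    have "convex {z. (f, g) \<bullet> z = c}" by (rule convex_hyperplane)
    then have "closed_segment a b \<subseteq> {z. (f, g) \<bullet> z = c}"
      using line by (intro closed_segment_subset) (auto simp: inner_prod_def)
    then show "closed_segment a b \<subseteq> N \<inter> {z. (f, g) \<bullet> z = c}"
      using closed_segment_subset[OF ab N] by auto
  qed
  moreover have "aff_dim (closed_segment a b) = 1"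
    using \<open>fst b < fst a\<close> by (auto simp: segment_convex_hull aff_dim_convex_hull)
  ultimately show ?thesis by (simp add: edge_of_def)
qed

text \<open>
  A point of \<open>N\<close> strictly below the supporting line and inside the box spanned by
  \<open>a\<close> and \<open>b\<close> is dominated by a point of the segment.
\<close>

lemma upper_right_corner_segment:
  fixes N :: "(real \<times> real) set"
  assumes N: "convex N" "closed N" and ab: "a \<in> N" "b \<in> N"
    and max: "\<And>z. z \<in> N \<Longrightarrow> f * fst z + g * snd z \<le> c"
    and line: "f * fst a + g * snd a = c" "f * fst b + g * snd b = c"
    and pos: "f > 0" "g > 0" and less: "fst b < fst a"
  shows "upper_right_corner N a b = closed_segment a b"
proof
  show "closed_segment a b \<subseteq> upper_right_corner N a b"
  proof
    fix z assume z: "z \<in> closed_segment a b"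
    then obtain t where t: "0 \<le> t" "t \<le> 1" "z = (1 - t) *\<^sub>R a + t *\<^sub>R b" unfolding in_segment by auto
    have zN: "z \<in> N" using z closed_segment_subset[OF ab N(1)] by auto
    have "f * fst z + g * snd z = (1 - t) * (f * fst a + g * snd a) + t * (f * fst b + g * snd b)"
      by (simp add: t(3) algebra_simps)
    then have zc: "f * fst z + g * snd z = c" by (simp add: line algebra_simps)
    have dom: "\<not> (fst z < fst w \<and> snd z < snd w)" if "w \<in> N" for w
    proof
      assume "fst z < fst w \<and> snd z < snd w"
      then have "f * fst z < f * fst w" "g * snd z < g * snd w" using pos by auto
      then show False using zc max[OF that] by linarith
    qed
    have "z \<notin> interior N"
    proof
      assume "z \<in> interior N"
      then obtain e where e: "e > 0" "ball z e \<subseteq> N" using mem_interior by blast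
      \<comment> \<open>an interior point is dominated by a nearby point on the diagonal through it\<close>
      define w where "w = z + (e / 3, e / 3)"
      have "dist z w \<le> dist (fst z) (fst w) + dist (snd z) (snd w)"
        by (simp add: dist_prod_def sqrt_sum_squares_le_sum)
      also have "\<dots> < e" using e(1) by (simp add: w_def dist_real_def)
      finally have "w \<in> N" using e by auto
      moreover have "fst z < fst w \<and> snd z < snd w" using e by (simp add: w_def)
      ultimately show False using dom by blast
    qed
    then have "z \<in> frontier N" using zN N(2) by (simp add: frontier_def)
    moreover have "snd a < snd b"
    proof -
      have "g * snd a < g * snd b" using line mult_strict_left_mono[OF less pos(1)] by linarith
      then show ?thesis using pos by simp
    qed
    moreover have "fst z = fst a - t * (fst a - fst b)" "fst z = fst b + (1 - t) * (fst a - fst b)"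
      "snd z = snd b - (1 - t) * (snd b - snd a)" "snd z = snd a + t * (snd b - snd a)"
      by (auto simp: t(3) algebra_simps)
    moreover have "0 \<le> t * (fst a - fst b)" "0 \<le> (1 - t) * (fst a - fst b)" using t less by auto
    moreover have "0 \<le> t * (snd b - snd a)" "0 \<le> (1 - t) * (snd b - snd a)" using t \<open>snd a < snd b\<close> by auto
    ultimately show "z \<in> upper_right_corner N a b" using dom unfolding upper_right_corner_def by auto
  qed
  show "upper_right_corner N a b \<subseteq> closed_segment a b"
  proof
    fix z assume "z \<in> upper_right_corner N a b"
    then have z: "z \<in> frontier N" "\<And>w. w \<in> N \<Longrightarrow> \<not> (fst z < fst w \<and> snd z < snd w)"
      "fst b \<le> fst z" "fst z \<le> fst a" "snd a \<le> snd z" "snd z \<le> snd b"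
      by (auto simp: upper_right_corner_def)
    have zN: "z \<in> N" using z(1) N(2) by (auto simp: frontier_def)
    have "f * fst z + g * snd z = c"
    proof (rule ccontr)
      assume "f * fst z + g * snd z \<noteq> c"
      then have lt: "f * fst z + g * snd z < c" using max[OF zN] by simp
      \<comment> \<open>the points of the line vertically above and horizontally to the right of \<open>z\<close>\<close>
      define w1 where "w1 = (fst z, (c - f * fst z) / g)"
      define w2 where "w2 = ((c - g * snd z) / f, snd z)"
      have on: "f * fst w1 + g * snd w1 = c" "f * fst w2 + g * snd w2 = c"
        using pos by (auto simp: w1_def w2_def)
      have gt: "fst z < fst w2" "snd z < snd w1" using lt pos by (auto simp: w1_def w2_def field_simps)
      have "g * snd a \<le> g * snd z" using z pos by simp
      then have "f * fst w2 \<le> f * fst a" using on(2) line(1) by (simp add: w2_def)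
      then have le: "fst w2 \<le> fst a" using pos by simp
      have "w1 \<in> closed_segment a b" "w2 \<in> closed_segment a b"
        using gt le z pos less by (auto intro!: on_line_in_segment[OF line] simp: on) (auto simp: w1_def)
      then have "midpoint w1 w2 \<in> closed_segment a b"
        using closed_segment_subset[OF _ _ convex_closed_segment] midpoint_in_closed_segment by blast
      then have "midpoint w1 w2 \<in> N" using closed_segment_subset[OF ab N(1)] by auto
      moreover have "fst z < fst (midpoint w1 w2) \<and> snd z < snd (midpoint w1 w2)"
        using gt by (simp add: midpoint_def w1_def w2_def)
      ultimately show False using z(2) by blast
    qed
    then show "z \<in> closed_segment a b"
      using on_line_in_segment[OF line] pos less z by auto
  qed
qed

text \<open>
  The supporting line at \<open>p\<close> keeps points of \<open>N\<close> out of the open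
  quadrant above and to the right of \<open>p\<close>, and points of the opposite open quadrant
  are dominated by \<open>p\<close>.
\<close>

lemma upper_right_corner_split:
  fixes N :: "(real \<times> real) set"
  assumes "p \<in> N" "\<And>z. z \<in> N \<Longrightarrow> f * fst z + g * snd z \<le> f * fst p + g * snd p" "f > 0" "g > 0"
    and "closed N" "fst b \<le> fst p" "fst p \<le> fst a" "snd a \<le> snd p" "snd p \<le> snd b"
  shows "upper_right_corner N a b = upper_right_corner N a p \<union> upper_right_corner N p b"
proof
  show "upper_right_corner N a p \<union> upper_right_corner N p b \<subseteq> upper_right_corner N a b"
    using assms(6-) by (auto simp: upper_right_corner_def)
  show "upper_right_corner N a b \<subseteq> upper_right_corner N a p \<union> upper_right_corner N p b"
  proof
    fix z assume z: "z \<in> upper_right_corner N a b"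
    then have "z \<in> N" using \<open>closed N\<close> by (auto simp: upper_right_corner_def frontier_def)
    then have le: "f * fst z + g * snd z \<le> f * fst p + g * snd p" by (rule assms(2))
    have ndom: "\<not> (fst z < fst p \<and> snd z < snd p)" using z assms(1) by (auto simp: upper_right_corner_def)
    have "fst p \<le> fst z \<and> snd z \<le> snd p \<or> fst z \<le> fst p \<and> snd p \<le> snd z"
    proof (cases "fst p \<le> fst z")
      case True
      then have "f * fst p \<le> f * fst z" using assms(3) by simp
      then have "g * snd z \<le> g * snd p" using le by linarith
      then show ?thesis using True assms(4) by simp
    qed (use ndom in auto)
    then show "z \<in> upper_right_corner N a p \<union> upper_right_corner N p b"
      using z by (auto simp: upper_right_corner_def)
  qed
qed

lemma lattice_hull_le:
  assumes "z \<in> convex hull (lattice_pt ` L)" "\<And>i j. (i, j) \<in> L \<Longrightarrow> f * real i + g * real j \<le> c"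
  shows "f * fst z + g * snd z \<le> c"
proof -
  have "convex hull (lattice_pt ` L) \<subseteq> {z. (f, g) \<bullet> z \<le> c}"
    using assms(2) by (intro hull_minimal convex_halfspace_le) (auto simp: lattice_pt_def inner_prod_def)
  then show ?thesis using assms(1) by (auto simp: inner_prod_def)
qed

text \<open>
  A finite set \<open>L\<close> of lattice points whose support function is the one of the
  implicit equation. Pairs \<open>(a0, b0)\<close> and \<open>(a1, b1)\<close> that describe no
  common pole are normalized to zero.
\<close>

locale polygon_support =
  fixes L :: "(nat \<times> nat) set" and m n a0 b0 a1 b1 :: nat
  assumes fin: "finite L"
    and supp_le: "\<And>i j u v. (i, j) \<in> L \<Longrightarrow> 0 < u \<Longrightarrow> 0 < v \<Longrightarrow>
      u * i + v * j + (min (u * b0) (v * a0) + min (u * b1) (v * a1)) \<le> u * m + v * n"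
    and supp_ex: "\<And>u v. 0 < u \<Longrightarrow> 0 < v \<Longrightarrow>
      \<exists>i j. (i, j) \<in> L \<and> u * i + v * j + (min (u * b0) (v * a0) + min (u * b1) (v * a1)) = u * m + v * n"
    and zero_iff: "a0 = 0 \<longleftrightarrow> b0 = 0" "a1 = 0 \<longleftrightarrow> b1 = 0"
    and sum_le: "a0 + a1 \<le> n" "b0 + b1 \<le> m"
begin

abbreviation "N \<equiv> convex hull (lattice_pt ` L)"
abbreviation "right_vertex \<equiv> lattice_pt (m, n - (a0 + a1))"
abbreviation "top_vertex \<equiv> lattice_pt (m - (b0 + b1), n)"

lemma closed_N: "closed N"
  using fin by (intro compact_imp_closed compact_convex_hull finite_imp_compact) simp

lemma box: assumes "(i, j) \<in> L" shows "i \<le> m" "j \<le> n"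
proof -
  have "(n + 1) * i + j \<le> (n + 1) * m + n" using supp_le[OF assms, of "n + 1" 1] by simp
  then have "(n + 1) * i < (n + 1) * (m + 1)" by simp
  then show "i \<le> m" by (metis mult_less_cancel1 Suc_eq_plus1 less_Suc_eq_le)
  have "i + (m + 1) * j \<le> m + (m + 1) * n" using supp_le[OF assms, of 1 "m + 1"] by simp
  then have "(m + 1) * j < (m + 1) * (n + 1)" by simp
  then show "j \<le> n" by (metis mult_less_cancel1 Suc_eq_plus1 less_Suc_eq_le)
qed

lemma box_N: assumes "z \<in> N" shows "fst z \<le> m" "snd z \<le> n"
  using lattice_hull_le[OF assms, of 1 0 m] lattice_hull_le[OF assms, of 0 1 n] box by auto

text \<open>
  The direction \<open>(n + 1, 1)\<close> is steep enough to select the rightmost column, and in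
  it the topmost point.
\<close>

lemma right_in_L: "(m, n - (a0 + a1)) \<in> L"
proof -
  have "a \<le> (n + 1) * b" if "a = 0 \<longleftrightarrow> b = 0" "a \<le> n" for a b :: nat
  proof (cases "b = 0")
    case False
    then have "n + 1 \<le> (n + 1) * b" by (cases b) auto
    then show ?thesis using that by linarith
  qed (use that in simp)
  then have "min ((n + 1) * b0) (1 * a0) = a0" "min ((n + 1) * b1) (1 * a1) = a1"
    using zero_iff sum_le by (simp_all add: min_absorb2)
  then obtain i j where ij: "(i, j) \<in> L" "(n + 1) * i + j + (a0 + a1) = (n + 1) * m + n"
    using supp_ex[of "n + 1" 1] by auto
  have "i = m"
  proof (rule ccontr)
    assume "i \<noteq> m"
    then have "i + 1 \<le> m" using box[OF ij(1)] by simp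
    then have "(n + 1) * (i + 1) \<le> (n + 1) * m" by (rule mult_le_mono2)
    then show False using ij(2) sum_le box[OF ij(1)] by (simp add: distrib_left)
  qed
  then have "j = n - (a0 + a1)" using ij(2) by simp
  with \<open>i = m\<close> ij(1) show ?thesis by simp
qed

lemma top_in_L: "(m - (b0 + b1), n) \<in> L"
proof -
  have "b \<le> (m + 1) * a" if "a = 0 \<longleftrightarrow> b = 0" "b \<le> m" for a b :: nat
  proof (cases "a = 0")
    case False
    then have "m + 1 \<le> (m + 1) * a" by (cases a) auto
    then show ?thesis using that by linarith
  qed (use that in simp)
  then have "min (1 * b0) ((m + 1) * a0) = b0" "min (1 * b1) ((m + 1) * a1) = b1"
    using zero_iff sum_le by (simp_all add: min_absorb1)
  then obtain i j where ij: "(i, j) \<in> L" "i + (m + 1) * j + (b0 + b1) = m + (m + 1) * n"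
    using supp_ex[of 1 "m + 1"] by auto
  have "j = n"
  proof (rule ccontr)
    assume "j \<noteq> n"
    then have "j + 1 \<le> n" using box[OF ij(1)] by simp
    then have "(m + 1) * (j + 1) \<le> (m + 1) * n" by (rule mult_le_mono2)
    then show False using ij(2) sum_le box[OF ij(1)] by (simp add: distrib_left)
  qed
  then have "i = m - (b0 + b1)" using ij(2) by simp
  with \<open>j = n\<close> ij(1) show ?thesis by simp
qed

lemma in_N: "(i, j) \<in> L \<Longrightarrow> lattice_pt (i, j) \<in> N"
  by (intro hull_inc imageI)

text \<open>
  The two normals are parallel or one of them is zero, so their sum is a normal of the whole edge.
\<close>

theorem single_edge:
  assumes par: "a0 * b1 = b0 * a1" and pos: "a0 + a1 > 0"
  shows "closed_segment right_vertex top_vertex edge_of N" "upper_right_corner N right_vertex top_vertex = closed_segment right_vertex top_vertex"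
proof -
  define f where "f = a0 + a1" define g where "g = b0 + b1"
  have fg: "f > 0" "g > 0" "f \<le> n" "g \<le> m" using pos zero_iff sum_le by (auto simp: f_def g_def)
  have eq: "f * b0 = g * a0" "f * b1 = g * a1" using par by (auto simp: f_def g_def algebra_simps)
  have le: "f * i + g * j + f * g \<le> f * m + g * n" if "(i, j) \<in> L" for i j
  proof -
    have "f * b0 + f * b1 = f * g" by (simp add: g_def distrib_left)
    then show ?thesis using supp_le[OF that fg(1,2)] eq by simp
  qed
  let ?c = "real f * real m + real g * real n - real f * real g"
  have leN: "real f * fst z + real g * snd z \<le> ?c" if "z \<in> N" for z
  proof (rule lattice_hull_le[OF that])
    fix i j assume "(i, j) \<in> L"
    from le[OF this] have "real (f * i + g * j + f * g) \<le> real (f * m + g * n)" by (simp only: of_nat_le_iff)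
    then show "real f * real i + real g * real j \<le> ?c" by simp
  qed
  have line: "real f * fst right_vertex + real g * snd right_vertex = ?c" "real f * fst top_vertex + real g * snd top_vertex = ?c"
    using fg by (auto simp: lattice_pt_def of_nat_diff algebra_simps simp flip: f_def g_def)
  have less: "fst top_vertex < fst right_vertex" using fg by (auto simp: lattice_pt_def simp flip: g_def)
  have in_N': "right_vertex \<in> N" "top_vertex \<in> N" using in_N right_in_L top_in_L by blast+
  show "closed_segment right_vertex top_vertex edge_of N"
  proof (rule closed_segment_edge_of[OF convex_convex_hull in_N' leN line _ less])
    fix z assume z: "z \<in> N" "real f * fst z + real g * snd z = ?c"
    have "real g * snd z \<le> real g * real n" using box_N[OF z(1)] by (simp add: mult_left_mono)
    then have "real f * fst top_vertex \<le> real f * fst z" using z(2) line(2) by (simp add: lattice_pt_def)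
    then show "fst top_vertex \<le> fst z \<and> fst z \<le> fst right_vertex" using fg box_N[OF z(1)] by (simp add: lattice_pt_def)
  qed (use fg in auto)
  show "upper_right_corner N right_vertex top_vertex = closed_segment right_vertex top_vertex"
    using fg by (intro upper_right_corner_segment[OF convex_convex_hull closed_N in_N' leN line _ _ less]) auto
qed

text \<open>
  The point \<open>p\<close> lies on the supporting lines with normals \<open>(a0, b0)\<close> and
  \<open>(a1, b1)\<close>. It belongs to the support because the maximum in the direction of the
  sum of these normals is attained, and a point attaining it lies on both lines.
\<close>

theorem two_edges:
  assumes less: "b0 * a1 < a0 * b1"
  defines "p \<equiv> lattice_pt (m - b0, n - a1)"
  shows "closed_segment right_vertex p edge_of N" "closed_segment p top_vertex edge_of N"
    "upper_right_corner N right_vertex top_vertex = closed_segment right_vertex p \<union> closed_segment p top_vertex"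
proof -
  have pos: "a0 > 0" "b0 > 0" "a1 > 0" "b1 > 0" using less zero_iff by (auto intro: Nat.gr0I)
  have sums: "b0 \<le> m" "a1 \<le> n" "b1 \<le> m - b0" "a0 \<le> n - a1" using sum_le by auto
  define X Y where "X = m - b0" and "Y = n - a1"
  have mn: "m = X + b0" "n = Y + a1" using sums by (auto simp: X_def Y_def)
  have line0: "a0 * i + b0 * j \<le> a0 * X + b0 * Y" if "(i, j) \<in> L" for i j
    using supp_le[OF that pos(1,2)] less unfolding mn by (simp add: min_def algebra_simps)
  have line1: "a1 * i + b1 * j \<le> a1 * X + b1 * Y" if "(i, j) \<in> L" for i j
    using supp_le[OF that pos(3,4)] less unfolding mn by (simp add: min_def algebra_simps split: if_splits)
  have "(X, Y) \<in> L"
  proof -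
    define u v where "u = a0 + a1" and "v = b0 + b1"
    have "min (u * b0) (v * a0) = u * b0" "min (u * b1) (v * a1) = v * a1"
      using less by (simp_all add: u_def v_def min_def algebra_simps)
    then obtain i j where ij: "(i, j) \<in> L" "u * i + v * j + (u * b0 + v * a1) = u * m + v * n"
      using supp_ex[of u v] pos by (auto simp: u_def v_def)
    have "u * i + v * j = u * X + v * Y" using ij(2) unfolding mn by (simp add: distrib_left)
    then have "(a0 * i + b0 * j) + (a1 * i + b1 * j) = (a0 * X + b0 * Y) + (a1 * X + b1 * Y)"
      by (simp add: u_def v_def algebra_simps)
    then have "a0 * i + b0 * j = a0 * X + b0 * Y" "a1 * i + b1 * j = a1 * X + b1 * Y"
      using line0[OF ij(1)] line1[OF ij(1)] by linarith+
    then have e: "int a0 * (int i - int X) + int b0 * (int j - int Y) = 0"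
      "int a1 * (int i - int X) + int b1 * (int j - int Y) = 0"
      by (simp_all add: algebra_simps flip: of_nat_mult of_nat_add)
    have d: "int a0 * int b1 - int b0 * int a1 \<noteq> 0" using less by (simp flip: of_nat_mult)
    have "(int a0 * int b1 - int b0 * int a1) * (int i - int X) = 0"
      "(int a0 * int b1 - int b0 * int a1) * (int j - int Y) = 0"
      using e by algebra+
    then have "i = X" "j = Y" using d by auto
    then show ?thesis using ij by simp
  qed
  then have pN: "p \<in> N" using in_N by (simp add: p_def X_def Y_def)
  have N: "right_vertex \<in> N" "top_vertex \<in> N" using in_N right_in_L top_in_L by blast+
  have "n - (a0 + a1) = Y - a0" "m - (b0 + b1) = X - b1" "a0 \<le> Y" "b1 \<le> X"
    using sums by (auto simp: X_def Y_def)
  then have coords: "fst p = real X" "snd p = real Y" "fst right_vertex = real m" "snd right_vertex = real Y - real a0"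
      "fst top_vertex = real X - real b1" "snd top_vertex = real n"
    by (simp_all add: lattice_pt_def p_def of_nat_diff flip: X_def Y_def)
  have mn_real: "real m = real X + real b0" "real n = real Y + real a1" by (simp_all add: mn)
  let ?c0 = "real a0 * real X + real b0 * real Y" and ?c1 = "real a1 * real X + real b1 * real Y"
  have le0: "real a0 * fst z + real b0 * snd z \<le> ?c0" if "z \<in> N" for z
  proof (rule lattice_hull_le[OF that])
    fix i j assume "(i, j) \<in> L"
    from line0[OF this] have "real (a0 * i + b0 * j) \<le> real (a0 * X + b0 * Y)" by (simp only: of_nat_le_iff)
    then show "real a0 * real i + real b0 * real j \<le> ?c0" by simp
  qed
  have le1: "real a1 * fst z + real b1 * snd z \<le> ?c1" if "z \<in> N" for z
  proof (rule lattice_hull_le[OF that])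
    fix i j assume "(i, j) \<in> L"
    from line1[OF this] have "real (a1 * i + b1 * j) \<le> real (a1 * X + b1 * Y)" by (simp only: of_nat_le_iff)
    then show "real a1 * real i + real b1 * real j \<le> ?c1" by simp
  qed
  have on: "real a0 * fst right_vertex + real b0 * snd right_vertex = ?c0" "real a0 * fst p + real b0 * snd p = ?c0"
    "real a1 * fst p + real b1 * snd p = ?c1" "real a1 * fst top_vertex + real b1 * snd top_vertex = ?c1"
    by (auto simp: coords mn_real algebra_simps)
  have lt: "fst p < fst right_vertex" "fst top_vertex < fst p" using pos by (auto simp: coords mn_real)
  have D: "real a0 * real b1 - real b0 * real a1 > 0" using less by (simp flip: of_nat_mult)
  show "closed_segment right_vertex p edge_of N"
  proof (rule closed_segment_edge_of[OF convex_convex_hull N(1) pN le0 on(1,2) _ lt(1)])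
    fix z assume z: "z \<in> N" "real a0 * fst z + real b0 * snd z = ?c0"
    have "real b0 * (real a1 * fst z + real b1 * snd z) \<le> real b0 * ?c1"
      using le1[OF z(1)] by (rule mult_left_mono) simp
    moreover have "real b1 * (real a0 * fst z + real b0 * snd z) = real b1 * ?c0" using z(2) by simp
    ultimately have "0 \<le> (real a0 * real b1 - real b0 * real a1) * (fst z - real X)"
      by (simp add: algebra_simps)
    then have "real X \<le> fst z" using D by (simp add: zero_le_mult_iff)
    then show "fst p \<le> fst z \<and> fst z \<le> fst right_vertex" using box_N[OF z(1)] coords mn_real by simp
  qed (use pos in auto)
  show "closed_segment p top_vertex edge_of N"
  proof (rule closed_segment_edge_of[OF convex_convex_hull pN N(2) le1 on(3,4) _ lt(2)])
    fix z assume z: "z \<in> N" "real a1 * fst z + real b1 * snd z = ?c1"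
    have "real b1 * (real a0 * fst z + real b0 * snd z) \<le> real b1 * ?c0"
      using le0[OF z(1)] by (rule mult_left_mono) simp
    moreover have "real b0 * (real a1 * fst z + real b1 * snd z) = real b0 * ?c1" using z(2) by simp
    ultimately have "(real a0 * real b1 - real b0 * real a1) * (fst z - real X) \<le> 0"
      by (simp add: algebra_simps)
    then have "fst z \<le> real X" using D by (simp add: mult_le_0_iff)
    moreover have "real b1 * snd z \<le> real b1 * snd top_vertex"
      using box_N[OF z(1)] by (simp add: mult_left_mono lattice_pt_def)
    then have "real a1 * fst top_vertex \<le> real a1 * fst z" using z(2) on(4) by linarith
    then have "fst top_vertex \<le> fst z" using pos by simp
    ultimately show "fst top_vertex \<le> fst z \<and> fst z \<le> fst p" using coords mn_real by simp
  qed (use pos in auto)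
  have "upper_right_corner N right_vertex top_vertex = upper_right_corner N right_vertex p \<union> upper_right_corner N p top_vertex"
    using pos le0 lt by (intro upper_right_corner_split[OF pN _ _ _ closed_N, where f = "real a0" and g = "real b0"])
      (auto simp: coords mn_real)
  also have "upper_right_corner N right_vertex p = closed_segment right_vertex p"
    using pos by (intro upper_right_corner_segment[OF convex_convex_hull closed_N N(1) pN le0 on(1,2) _ _ lt(1)]) auto
  also have "upper_right_corner N p top_vertex = closed_segment p top_vertex"
    using pos by (intro upper_right_corner_segment[OF convex_convex_hull closed_N pN N(2) le1 on(3,4) _ _ lt(2)]) auto
  finally show "upper_right_corner N right_vertex top_vertex = closed_segment right_vertex p \<union> closed_segment p top_vertex" .
qed

end

section \<open>The upper right corner of the Newton polygon\<close>

lemma coeff_part_poly: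
  assumes "finite (S p)"
  shows "coeff (part_poly S c p) k = (if k \<in> S p then c (p, k) else 0)"
  using assms by (simp add: part_poly_def coeff_sum)

lemma degree_part_poly:
  assumes "finite (S p)" "\<forall>k\<in>S p. c (p, k) \<noteq> 0" "S p \<noteq> {}"
  shows "degree (part_poly S c p) = Max (S p)"
proof (rule antisym)
  show "degree (part_poly S c p) \<le> Max (S p)"
    using assms by (intro degree_le) (auto simp: coeff_part_poly)
  show "Max (S p) \<le> degree (part_poly S c p)"
    using assms by (intro le_degree) (simp add: coeff_part_poly)
qed

lemma max_degree_part_poly:
  assumes "finite (S p)" "finite (S q)" "\<forall>p. \<forall>k\<in>S p. c (p, k) \<noteq> 0" "S q \<noteq> {}"
  shows "max (degree (part_poly S c p)) (degree (part_poly S c q)) = Max (S p \<union> S q)"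
proof (cases "S p = {}")
  case True
  then show ?thesis using assms by (simp add: degree_part_poly part_poly_def[of S c p])
next
  case False
  then show ?thesis using assms by (simp add: degree_part_poly Max_Un)
qed

lemma part_poly_trimmed:
  assumes "finite (S p)"
  shows "part_poly S c p = monom 1 (Min (S p)) * trimmed S c p"
  using assms by (simp add: part_poly_def trimmed_def sum_distrib_left mult_monom)

text \<open>
  Otherwise \<open>t\<close> divides both polynomials.
\<close>

lemma zero_mem_of_coprime:
  assumes "finite (S p)" "finite (S q)" "coprime (part_poly S c p) (part_poly S c q)"
  shows "0 \<in> S p \<union> S q"
proof (rule ccontr)
  assume "0 \<notin> S p \<union> S q"
  then have "poly (part_poly S c p) 0 = 0" "poly (part_poly S c q) 0 = 0"
    using assms by (simp_all add: poly_0_coeff_0 coeff_part_poly)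
  then show False using no_common_root_of_coprime[OF assms(3)] by blast
qed

text \<open>
  A constant parameterization has infinite fibres, and these have cardinality 0 by convention.
\<close>

lemma not_constant_of_degree_1:
  assumes "has_param_degree F 1" "F Q0 \<noteq> 0" "F Q1 \<noteq> 0"
  shows "\<not> (\<forall>p. degree (F p) = 0)"
proof
  assume "\<forall>p. degree (F p) = 0"
  then have const: "poly (F p) t = coeff (F p) 0" for p t
    by (metis degree_eq_zeroE poly_const_conv poly_0_coeff_0)
  have nz: "coeff (F Q0) 0 \<noteq> 0" "coeff (F Q1) 0 \<noteq> 0"
    using assms \<open>\<forall>p. degree (F p) = 0\<close> by (metis leading_coeff_0_iff)+
  then have "param_dom F = UNIV" by (simp add: param_dom_def const)
  moreover have "param F s = param F t" for s t by (simp add: param_def const)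
  ultimately show False
    using assms(1) infinite_UNIV_char_0[where 'a=complex] by (simp add: has_param_degree_def)
qed

text \<open>
  A direction with a common factor \<open>d\<close> reduces to the coprime case, as both sides of
  the formula scale with \<open>d\<close>. The formula itself is turned from a maximum into a
  minimum via \<open>max (X - a) (X - b) = X - min a b\<close>.
\<close>

lemma polygon_support_implicit_equation:
  assumes "proper_parametrization F \<alpha> \<beta> q0 q1" "implicit_equation F \<phi>"
    and m: "m = max (degree (F P1)) (degree (F Q1))" and n: "n = max (degree (F P0)) (degree (F Q0))"
    and min0: "\<And>u v. min (u * b0) (v * a0) = min (u * \<beta>) (v * \<alpha>)"
    and min1: "\<And>u v. min (u * b1) (v * a1) = min (u * (m - degree (F Q1))) (v * (n - degree (F Q0)))"
    and "a0 = 0 \<longleftrightarrow> b0 = 0" "a1 = 0 \<longleftrightarrow> b1 = 0" "a0 + a1 \<le> n" "b0 + b1 \<le> m"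
  shows "polygon_support (support \<phi>) m n a0 b0 a1 b1"
proof
  interpret proper_parametrization F \<alpha> \<beta> q0 q1 by fact
  have mn: "degree (F Q1) \<le> m" "degree (F Q0) \<le> n" by (auto simp: m n)
  have \<alpha>\<beta>: "\<alpha> \<le> degree (F Q0)" "\<beta> \<le> degree (F Q1)"
    using Q_nonzero by (simp_all add: Q0_eq Q1_eq degree_mult_eq degree_monom_eq)
  have total: "weighted_degree u v \<phi> + (min (u * b0) (v * a0) + min (u * b1) (v * a1)) = u * m + v * n"
    if "u > 0" "v > 0" "coprime u v" for u v
  proof -
    define x y where "x = m - degree (F Q1)" and "y = n - degree (F Q0)"
    have e: "m = degree (F Q1) + x" "n = degree (F Q0) + y" using mn by (simp_all add: x_def y_def)
    have "max (v * n + u * degree (F Q1)) (u * m + v * degree (F Q0)) + min (u * x) (v * y) = u * m + v * n"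
      unfolding e by (simp add: distrib_left max_def min_def)
    moreover have "min (u * \<beta>) (v * \<alpha>) \<le> max (v * n + u * degree (F Q1)) (u * m + v * degree (F Q0))"
      using \<alpha>\<beta>(2) by (simp add: le_max_iff_disj min_le_iff_disj trans_le_add2)
    ultimately show ?thesis
      unfolding min0 min1 weighted_degree_implicit_equation(2)[OF assms(2) that] m[symmetric] n[symmetric]
        x_def[symmetric] y_def[symmetric] by simp
  qed
  have reduce: "\<exists>d u' v'. d > 0 \<and> u = d * u' \<and> v = d * v' \<and> u' > 0 \<and> v' > 0 \<and> coprime u' v'"
    if "u > 0" "v > 0" for u v :: nat
  proof -
    have "gcd u v \<noteq> 0" using that by simp
    then obtain u' v' where uv: "u = u' * gcd u v" "v = v' * gcd u v" "coprime u' v'"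
      using gcd_coprime_exists by blast
    then show ?thesis using that
      by (intro exI[of _ "gcd u v"] exI[of _ u'] exI[of _ v']) (auto simp: mult.commute intro: Nat.gr0I)
  qed
  have \<phi>: "\<phi> \<noteq> 0" using weighted_degree_implicit_equation(1)[OF assms(2), of 1 1] by simp
  have scale: "d * u * i + d * v * j + (min (d * u * b0) (d * v * a0) + min (d * u * b1) (d * v * a1)) =
      d * (u * i + v * j + (min (u * b0) (v * a0) + min (u * b1) (v * a1)))" for d u v i j :: nat
    by (simp add: distrib_left mult.assoc nat_mult_min_right)
  show "finite (support \<phi>)" by (rule finite_support)
  show "u * i + v * j + (min (u * b0) (v * a0) + min (u * b1) (v * a1)) \<le> u * m + v * n"
    if ij: "(i, j) \<in> support \<phi>" and uv: "0 < u" "0 < v" for i j u v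
  proof -
    obtain d u' v' where d: "d > 0" "u = d * u'" "v = d * v'" "u' > 0" "v' > 0" "coprime u' v'"
      using reduce[OF uv] by blast
    have "u' * i + v' * j \<le> weighted_degree u' v' \<phi>"
      unfolding weighted_degree_def using ij finite_support by (intro Max_ge) force+
    then have "u' * i + v' * j + (min (u' * b0) (v' * a0) + min (u' * b1) (v' * a1)) \<le> u' * m + v' * n"
      using total[OF d(4-6)] by simp
    then have "d * (u' * i + v' * j + (min (u' * b0) (v' * a0) + min (u' * b1) (v' * a1))) \<le> d * (u' * m + v' * n)"
      by (rule mult_le_mono2)
    then show ?thesis unfolding d(2,3) scale by (simp add: distrib_left mult.assoc)
  qed
  show "\<exists>i j. (i, j) \<in> support \<phi> \<and>
      u * i + v * j + (min (u * b0) (v * a0) + min (u * b1) (v * a1)) = u * m + v * n"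
    if uv: "0 < u" "0 < v" for u v
  proof -
    obtain d u' v' where d: "d > 0" "u = d * u'" "v = d * v'" "u' > 0" "v' > 0" "coprime u' v'"
      using reduce[OF uv] by blast
    have "weighted_degree u' v' \<phi> \<in> (\<lambda>(i, j). u' * i + v' * j) ` support \<phi>"
      unfolding weighted_degree_def using finite_support \<phi> by (intro Max_in) (auto simp: support_eq_empty_iff)
    then obtain i j where ij: "(i, j) \<in> support \<phi>" "weighted_degree u' v' \<phi> = u' * i + v' * j" by auto
    have "d * (u' * i + v' * j + (min (u' * b0) (v' * a0) + min (u' * b1) (v' * a1))) = d * (u' * m + v' * n)"
      using total[OF d(4-6)] ij(2) by simp
    then show ?thesis
      using ij(1) unfolding d(2,3) scale by (intro exI[of _ i] exI[of _ j]) (simp add: distrib_left mult.assoc)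
  qed
qed (use assms in auto)

theorem theorem30:
  fixes S :: "part \<Rightarrow> nat set"
  assumes "\<And>p. finite (S p)"
    and "S Q0 \<noteq> {}" and "S Q1 \<noteq> {}"
    and "generically S (\<lambda>c. let F = part_poly S c in
           coprime (F P0) (F Q0) \<and> coprime (F P1) (F Q1) \<and> has_param_degree F 1)"
    and "e1_max_e0_max S \<noteq> Max (A0 S) - Min (A0 S)"
  shows "(no_min_selected S \<or> no_max_selected S) \<and>
         e0_max_e1_max S \<noteq> Max (A1 S) - Min (A1 S) \<and>
         generically S (\<lambda>c. \<forall>\<phi>. implicit_equation (part_poly S c) \<phi> \<longrightarrow>
           (let N = newton_polygon \<phi>; a = right_pt S; b = top_pt S; p = middle_pt S in
            if no_min_selected S \<and> no_max_selected S \<and> delta S \<noteq> 0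
            then closed_segment a p edge_of N \<and> closed_segment p b edge_of N \<and>
                 upper_right_corner N a b = closed_segment a p \<union> closed_segment p b
            else closed_segment a b edge_of N \<and>
                 upper_right_corner N a b = closed_segment a b))"
proof -
  note fin = assms(1)
  define R where "R c \<longleftrightarrow> coprime_poles S c \<and> coprime (part_poly S c P0) (part_poly S c Q0) \<and>
    coprime (part_poly S c P1) (part_poly S c Q1) \<and> has_param_degree (part_poly S c) 1" for c
  have gen: "generically S R"
    using generically_conj[OF generically_coprime_poles[OF fin assms(2,3)] assms(4)]
    by (simp add: R_def[abs_def] Let_def)
  define m n where "m = Max (A1 S)" and "n = Max (A0 S)"
  have finA: "finite (A0 S)" "finite (A1 S)" and sub: "S Q0 \<subseteq> A0 S" "S Q1 \<subseteq> A1 S"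
    using fin by (auto simp: A0_def A1_def)
  have deg: "max (degree (part_poly S c P0)) (degree (part_poly S c Q0)) = n"
      "max (degree (part_poly S c P1)) (degree (part_poly S c Q1)) = m"
      "degree (part_poly S c Q0) = Max (S Q0)" "degree (part_poly S c Q1) = Max (S Q1)"
    if "R c" for c
  proof -
    have nz: "\<forall>p. \<forall>k\<in>S p. c (p, k) \<noteq> 0" using that by (simp add: R_def coprime_poles_def)
    show "max (degree (part_poly S c P0)) (degree (part_poly S c Q0)) = n"
      "max (degree (part_poly S c P1)) (degree (part_poly S c Q1)) = m"
      unfolding m_def n_def A0_def A1_def by (intro max_degree_part_poly fin nz assms(2,3))+
    show "degree (part_poly S c Q0) = Max (S Q0)" "degree (part_poly S c Q1) = Max (S Q1)"
      using nz by (intro degree_part_poly fin assms(2,3); blast)+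
  qed
  \<comment> \<open>facts about the supports alone can be read off from any one generic coefficient vector\<close>
  obtain c where c: "R c" using generically_obtains[OF gen] .
  have min0: "Min (A0 S) = 0" "Min (A1 S) = 0"
    using zero_mem_of_coprime[of S P0 Q0 c] zero_mem_of_coprime[of S P1 Q1 c] c fin finA
    by (auto simp: R_def A0_def A1_def intro!: Min_eqI)
  have nontriv: "0 < n \<or> 0 < m"
  proof (rule ccontr)
    assume "\<not> (0 < n \<or> 0 < m)"
    then have "degree (part_poly S c p) = 0" for p using deg(1,2)[OF c] by (cases p) auto
    moreover have "part_poly S c Q0 \<noteq> 0" "part_poly S c Q1 \<noteq> 0"
      using c fin assms(2,3) unfolding R_def coprime_poles_def
      by (metis coeff_0 coeff_part_poly ex_in_conv)+
    ultimately show False using not_constant_of_degree_1[of "part_poly S c"] c by (auto simp: R_def)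
  qed
  have extremes: "Min (S Q0) \<le> Max (S Q0)" "Max (S Q0) \<le> n" "Min (S Q1) \<le> Max (S Q1)" "Max (S Q1) \<le> m"
    using fin assms(2,3) sub finA by (auto simp: n_def m_def intro!: Max_mono)
  \<comment> \<open>the pole orders at \<open>0\<close> and at infinity, set to zero unless both coordinates have a pole there\<close>
  define a0 where "a0 = (if no_min_selected S then Min (S Q0) else 0)"
  define b0 where "b0 = (if no_min_selected S then Min (S Q1) else 0)"
  define a1 where "a1 = (if no_max_selected S then n - Max (S Q0) else 0)"
  define b1 where "b1 = (if no_max_selected S then m - Max (S Q1) else 0)"
  have no_min: "no_min_selected S \<longleftrightarrow> Min (S Q0) \<noteq> 0 \<and> Min (S Q1) \<noteq> 0"
  proof -
    have "0 \<in> S p \<longleftrightarrow> Min (S p) = 0" if "S p \<noteq> {}" for p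
      using that fin[of p] by (metis Min_eqI Min_in le0)
    then show ?thesis using assms(2,3) by (simp add: no_min_selected_def min0)
  qed
  have no_max: "no_max_selected S \<longleftrightarrow> Max (S Q0) \<noteq> n \<and> Max (S Q1) \<noteq> m"
  proof -
    have "n \<in> S Q0 \<longleftrightarrow> Max (S Q0) = n" "m \<in> S Q1 \<longleftrightarrow> Max (S Q1) = m"
      using extremes fin assms(2,3) by (metis Max_ge Max_in antisym)+
    then show ?thesis by (simp add: no_max_selected_def flip: n_def m_def)
  qed
  have zero_iff: "a0 = 0 \<longleftrightarrow> b0 = 0" "a1 = 0 \<longleftrightarrow> b1 = 0"
    using no_min no_max extremes by (auto simp: a0_def b0_def a1_def b1_def)
  have zero_iff': "a0 = 0 \<longleftrightarrow> \<not> no_min_selected S" "a1 = 0 \<longleftrightarrow> \<not> no_max_selected S"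
    using no_min no_max extremes by (auto simp: a0_def a1_def)
  have sum_le: "a0 + a1 \<le> n" "b0 + b1 \<le> m"
    using extremes by (auto simp: a0_def b0_def a1_def b1_def)
  have e1: "e1_max_e0_max S = n - (a0 + a1)"
  proof -
    have "e1_max_e0_max S = Max (A0 S) - Min (A0 S) - uncovered (A0 S) (S Q0) (A1 S) (S Q1)"
      using cond_max_apex_sum[of 0 1, OF _ finA sub assms(2,3)] nontriv
      by (simp add: e1_max_e0_max_def e1_def[abs_def] e0_def[abs_def] row_config_def min0 flip: n_def m_def)
    then show ?thesis
      by (simp add: uncovered_def a0_def a1_def no_min_selected_def no_max_selected_def min0 flip: n_def)
  qed
  have e0: "e0_max_e1_max S = m - (b0 + b1)"
  proof -
    have "e0_max_e1_max S = Max (A1 S) - Min (A1 S) - uncovered (A1 S) (S Q1) (A0 S) (S Q0)"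
      using cond_max_apex_sum[of 1 0, OF _ finA(2,1) sub(2,1) assms(3,2)] nontriv[THEN disj_commute[THEN iffD1]]
      by (simp add: e0_max_e1_max_def e1_def[abs_def] e0_def[abs_def] row_config_def min0 flip: n_def m_def)
    then show ?thesis
      by (simp add: uncovered_def b0_def b1_def no_min_selected_def no_max_selected_def min0 conj_commute flip: m_def)
  qed
  have pos: "a0 + a1 > 0" using assms(5) e1 by (auto simp: min0 simp flip: n_def)
  then have selected: "no_min_selected S \<or> no_max_selected S" using zero_iff' by auto
  have pos': "b0 + b1 > 0" using pos zero_iff by auto
  have pts: "right_pt S = lattice_pt (m, n - (a0 + a1))" "top_pt S = lattice_pt (m - (b0 + b1), n)"
    by (simp_all add: right_pt_def top_pt_def e0 e1 min0 flip: m_def n_def)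
  have corner: "let N = newton_polygon \<phi>; a = right_pt S; b = top_pt S; p = middle_pt S in
            if no_min_selected S \<and> no_max_selected S \<and> delta S \<noteq> 0
            then closed_segment a p edge_of N \<and> closed_segment p b edge_of N \<and>
                 upper_right_corner N a b = closed_segment a p \<union> closed_segment p b
            else closed_segment a b edge_of N \<and>
                 upper_right_corner N a b = closed_segment a b"
    if c: "R c" and \<phi>: "implicit_equation (part_poly S c) \<phi>" for c \<phi>
  proof -
    have nz: "c (Q0, Min (S Q0)) \<noteq> 0" "c (Q1, Min (S Q1)) \<noteq> 0"
      using c fin assms(2,3) by (auto simp: R_def coprime_poles_def)
    have pp: "proper_parametrization (part_poly S c) (Min (S Q0)) (Min (S Q1)) (trimmed S c Q0) (trimmed S c Q1)"
    proof
      show "part_poly S c Q0 = monom 1 (Min (S Q0)) * trimmed S c Q0"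
        "part_poly S c Q1 = monom 1 (Min (S Q1)) * trimmed S c Q1"
        by (rule part_poly_trimmed[OF fin])+
      show "max (degree (part_poly S c P0)) (degree (part_poly S c Q0)) > 0"
        "max (degree (part_poly S c P1)) (degree (part_poly S c Q1)) > 0"
        using pos pos' sum_le unfolding deg(1,2)[OF c] by linarith+
    qed (use c nz in \<open>auto simp: R_def coprime_poles_def poly_trimmed_0 fin assms(2,3)\<close>)
    have supp: "polygon_support (support \<phi>) m n a0 b0 a1 b1"
    proof (rule polygon_support_implicit_equation[OF pp \<phi> _ _ _ _ zero_iff sum_le])
      show "min (u * b0) (v * a0) = min (u * Min (S Q1)) (v * Min (S Q0))" for u v
        using no_min by (auto simp: a0_def b0_def)
      show "min (u * b1) (v * a1) = min (u * (m - degree (part_poly S c Q1))) (v * (n - degree (part_poly S c Q0)))" for u v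
        unfolding deg[OF c] using no_max by (auto simp: a1_def b1_def)
    qed (simp_all only: deg(1,2)[OF c])
    then interpret polygon_support "support \<phi>" m n a0 b0 a1 b1 .
    have N: "newton_polygon \<phi> = convex hull (lattice_pt ` support \<phi>)"
      by (simp add: newton_polygon_def support_def)
    have delta: "delta S = int (b0 * a1) - int (a0 * b1)" if "no_min_selected S \<and> no_max_selected S"
      using that extremes
      by (simp add: delta_def min0 a0_def b0_def a1_def b1_def of_nat_diff mult.commute flip: n_def m_def)
    show ?thesis
    proof (cases "no_min_selected S \<and> no_max_selected S \<and> delta S \<noteq> 0")
      case True
      show ?thesis
      proof (cases "delta S < 0")
        case neg: True
        then have "int (b0 * a1) < int (a0 * b1)" using delta True by linarith
        then have less: "b0 * a1 < a0 * b1" by (simp only: of_nat_less_iff)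
        have "middle_pt S = lattice_pt (m - b0, n - a1)"
          using neg True extremes by (simp add: middle_pt_def a1_def b0_def min0 flip: m_def n_def)
        then show ?thesis using two_edges[OF less] True by (simp add: Let_def pts N)
      next
        case False
        then have "int (a0 * b1) < int (b0 * a1)" using delta True by linarith
        then have less: "b1 * a0 < a1 * b0" by (simp only: of_nat_less_iff mult.commute)
        interpret swap: polygon_support "support \<phi>" m n a1 b1 a0 b0
          using fin supp_le supp_ex zero_iff sum_le by unfold_locales (auto simp: add.commute finite_support)
        have "middle_pt S = lattice_pt (m - b1, n - a0)"
          using False True extremes by (simp add: middle_pt_def b1_def a0_def min0 flip: m_def n_def)
        then show ?thesis using swap.two_edges[OF less] True by (simp add: Let_def pts N add.commute)
      qed
    next
      case False
      have par: "a0 * b1 = b0 * a1"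
      proof (cases "no_min_selected S \<and> no_max_selected S")
        case True
        then have "int (b0 * a1) - int (a0 * b1) = 0" using False delta by simp
        then show ?thesis by (simp only: right_minus_eq of_nat_eq_iff)
      qed (auto simp: a0_def b0_def a1_def b1_def)
      then show ?thesis using single_edge[OF par pos] False by (auto simp: Let_def pts N)
    qed
  qed
  have "e0_max_e1_max S \<noteq> Max (A1 S) - Min (A1 S)"
  proof -
    have "m - (b0 + b1) \<noteq> m" using pos' sum_le by linarith
    then show ?thesis by (simp only: e0 min0 m_def[symmetric] diff_zero not_False_eq_True)
  qed
  moreover have "generically S (\<lambda>c. \<forall>\<phi>. implicit_equation (part_poly S c) \<phi> \<longrightarrow>
           (let N = newton_polygon \<phi>; a = right_pt S; b = top_pt S; p = middle_pt S in
            if no_min_selected S \<and> no_max_selected S \<and> delta S \<noteq> 0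
            then closed_segment a p edge_of N \<and> closed_segment p b edge_of N \<and>
                 upper_right_corner N a b = closed_segment a p \<union> closed_segment p b
            else closed_segment a b edge_of N \<and>
                 upper_right_corner N a b = closed_segment a b))"
    by (rule generically_mono[OF gen]) (use corner in blast)
  ultimately show ?thesis using selected by blast
qed

end
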